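(* Let $X$ be a nonzero complex Banach space with open unit ball $\mathbb{B}$, let $0\le\alpha<1$, let $g:\mathbb{B}\to\mathbb{C}$ be holomorphic with $g(0)=1$, and define $F(x)=g(x)x$ for $x\in\mathbb{B}$. Suppose that $F\in\mathcal{S}^*_{\mathbb{B}}(\alpha)$. Then for every $x_0\in X$ with $\|x_0\|=1$ and every $T_{x_0}\in T(x_0)$, $$|H_{2,1}(F)|=|A_3-A_2^2|\le 1-\alpha .$$ Moreover, the estimate is sharp: for every nonzero complex Banach space $X$ and every $0\le\alpha<1$ there are a mapping $F\in\mathcal{S}^*_{\mathbb{B}}(\alpha)$ of the form $F(x)=g(x)x$ with $g:\mathbb{B}\to\mathbb{C}$ holomorphic and $g(0)=1$, a unit vector $x_0$ and $T_{x_0}\in T(x_0)$ for which equality $|A_3-A_2^2|=1-\alpha$ holds.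
   Context: $X$ is a complex Banach space with norm $\|\cdot\|$ and $\mathbb{B}=\{x\in X:\|x\|<1\}$. For $x\in X\setminus\{0\}$, $T(x)$ is the (nonempty) set of bounded linear functionals $T_x:X\to\mathbb{C}$ with $\|T_x\|=1$ and $T_x(x)=\|x\|$. For holomorphic $F:\mathbb{B}\to X$, $DF(x)$ is the Fréchet derivative at $x$, $D^nF(x)$ is the $n$th Fréchet derivative (a bounded symmetric $n$-linear map $X^n\to X$). $F$ is normalized if $F(0)=0$ and $DF(0)=I$ (the identity), and locally biholomorphic if $DF(x)$ is invertible with bounded inverse for every $x\in\mathbb{B}$. Class $\mathcal{S}^*_{\mathbb{B}}(\alpha)$ (starlike mappings of order $\alpha$): for $0<\alpha<1$, the set of normalized locally biholomorphic $F:\mathbb{B}\to X$ such that $$\left|\frac{1}{\|x\|}T_x\big((DF(x))^{-1}F(x)\big)-\frac{1}{2\alpha}\right|<\frac{1}{2\alpha}\quad\text{for all }x\in\mathbb{B}\setminus\{0\},\ T_x\in T(x);$$ equivalently, $\operatorname{Re}\big(\|x\|/T_x((DF(x))^{-1}F(x))\big)>\alpha$ for all such $x,T_x$. For $\alpha=0$, $\mathcal{S}^*_{\mathbb{B}}(0)=\mathcal{S}^*_{\mathbb{B}}$ is the set of normalized locally biholomorphic $F$ with $\operatorname{Re}\,T_x((DF(x))^{-1}F(x))>0$ for all $x\in\mathbb{B}\setminus\{0\}$, $T_x\in T(x)$. Given $x_0$ with $\|x_0\|=1$ and $T_{x_0}\in T(x_0)$, put $A_n=\frac{1}{n!}T_{x_0}\big(D^nF(0)(x_0,\ldots,x_0)\big)$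 ($x_0$ repeated $n$ times) for $n=2,3$. *)

theory Defs
  imports "HOL-Analysis.Analysis"
begin

class complex_normed_vector = real_normed_vector +
  fixes scaleC :: "complex \<Rightarrow> 'a \<Rightarrow> 'a"  (infixr "*\<^sub>C" 75)
  assumes scaleC_add_right: "c *\<^sub>C (x + y) = c *\<^sub>C x + c *\<^sub>C y"
    and scaleC_add_left: "(c + d) *\<^sub>C x = c *\<^sub>C x + d *\<^sub>C x"
    and scaleC_scaleC: "c *\<^sub>C (d *\<^sub>C x) = (c * d) *\<^sub>C x"
    and scaleR_scaleC: "scaleR r x = complex_of_real r *\<^sub>C x"
    and norm_scaleC: "norm (c *\<^sub>C x) = cmod c * norm x"

class complex_banach = complex_normed_vector + banach

instantiation complex :: complex_banach
begin

definition scaleC_complex :: "complex \<Rightarrow> complex \<Rightarrow> complex"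
  where "scaleC_complex c z = c * z"

instance
  by standard (auto simp: scaleC_complex_def algebra_simps norm_mult scaleR_conv_of_real)

end

definition bounded_clinear ::
    "('a::complex_normed_vector \<Rightarrow> 'b::complex_normed_vector) \<Rightarrow> bool"
  where "bounded_clinear f \<longleftrightarrow>
    bounded_linear f \<and> (\<forall>c x. f (c *\<^sub>C x) = c *\<^sub>C f x)"

text \<open>Complex Frechet differentiability at every point of an open set.\<close>

definition frechet_holomorphic_on ::
    "('a::complex_normed_vector \<Rightarrow> 'b::complex_normed_vector) \<Rightarrow> 'a set \<Rightarrow> bool"
  where "frechet_holomorphic_on f S \<longleftrightarrow>
    open S \<and> (\<forall>x\<in>S. \<exists>D. bounded_clinear D \<and> (f has_derivative D) (at x))"

text \<open>
  The Frechet derivative as a point of the operator space. Iterating it gives the higher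
  derivatives in curried form: the second one takes values in
  \<open>'a \<Rightarrow>\<^sub>L 'a \<Rightarrow>\<^sub>L 'b\<close>, and so on. The operator spaces
  are the real ones, but on an open set where the function is holomorphic the derivatives
  are those over the complex numbers, since a Frechet derivative is unique and bounded
  complex linear maps carry the same operator norm when seen as real linear maps.
\<close>

definition fderiv ::
    "('a::real_normed_vector \<Rightarrow> 'b::real_normed_vector) \<Rightarrow> 'a \<Rightarrow> 'a \<Rightarrow>\<^sub>L 'b"
  where "fderiv f x = Blinfun (frechet_derivative f (at x))"

definition support_functionals :: "'a::complex_normed_vector \<Rightarrow> ('a \<Rightarrow>\<^sub>L complex) set"
  where "support_functionals x =
    {T. bounded_clinear (blinfun_apply T) \<and> norm T = 1 \<and>
        blinfun_apply T x = complex_of_real (norm x)}"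

definition normalized :: "('a::real_normed_vector \<Rightarrow> 'a) \<Rightarrow> bool"
  where "normalized F \<longleftrightarrow> F 0 = 0 \<and> fderiv F 0 = id_blinfun"

definition locally_biholomorphic :: "('a::complex_normed_vector \<Rightarrow> 'a) \<Rightarrow> bool"
  where "locally_biholomorphic F \<longleftrightarrow>
    frechet_holomorphic_on F (ball 0 1) \<and>
    (\<forall>x\<in>ball 0 1. \<exists>G :: 'a \<Rightarrow>\<^sub>L 'a.
       G o\<^sub>L fderiv F x = id_blinfun \<and> fderiv F x o\<^sub>L G = id_blinfun)"

definition starlike_field :: "('a::real_normed_vector \<Rightarrow> 'a) \<Rightarrow> 'a \<Rightarrow> 'a"
  where "starlike_field F x = inv (blinfun_apply (fderiv F x)) (F x)"

text \<open>
  Mappings of the unit ball are represented by total functions; only their values on the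
  ball matter. The order is meant to lie in the half-open interval from 0 to 1.
\<close>

definition starlike_mappings :: "real \<Rightarrow> ('a::complex_normed_vector \<Rightarrow> 'a) set"
  where "starlike_mappings \<alpha> =
    {F. normalized F \<and> locally_biholomorphic F \<and>
        (\<forall>x\<in>ball 0 1 - {0}. \<forall>T\<in>support_functionals x.
           if \<alpha> = 0 then Re (blinfun_apply T (starlike_field F x)) > 0
           else cmod (complex_of_real (1 / norm x) * blinfun_apply T (starlike_field F x)
                      - complex_of_real (1 / (2 * \<alpha>))) < 1 / (2 * \<alpha>))}"

definition coeff2 ::
    "('a::complex_normed_vector \<Rightarrow> 'a) \<Rightarrow> 'a \<Rightarrow> ('a \<Rightarrow>\<^sub>L complex) \<Rightarrow> complex"
  where "coeff2 F x T =
    1 / fact 2 * blinfun_apply T (blinfun_apply (blinfun_apply (fderiv (fderiv F) 0) x) x)"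

definition coeff3 ::
    "('a::complex_normed_vector \<Rightarrow> 'a) \<Rightarrow> 'a \<Rightarrow> ('a \<Rightarrow>\<^sub>L complex) \<Rightarrow> complex"
  where "coeff3 F x T =
    1 / fact 3 * blinfun_apply T
      (blinfun_apply (blinfun_apply (blinfun_apply (fderiv (fderiv (fderiv F)) 0) x) x) x)"

definition hankel_2_1 ::
    "('a::complex_normed_vector \<Rightarrow> 'a) \<Rightarrow> 'a \<Rightarrow> ('a \<Rightarrow>\<^sub>L complex) \<Rightarrow> complex"
  where "hankel_2_1 F x T = coeff3 F x T - (coeff2 F x T)\<^sup>2"

end

theory Submission
  imports Defs "HOL-Complex_Analysis.Complex_Analysis"
begin

text \<open>
  Since \<open>DF(x)x = (g(x) + Dg(x)x) x\<close>, on the complex line through \<open>x\<^sub>0\<close> the starlikeness condition says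
  that \<open>p(\<zeta>) = 1 + \<zeta>\<phi>'(\<zeta>)/\<phi>(\<zeta>)\<close> with \<open>\<phi>(\<zeta>) = g(\<zeta>x\<^sub>0)\<close> satisfies \<open>Re p > \<alpha>\<close>, while
  \<open>A\<^sub>2 = \<phi>'(0)\<close> and \<open>A\<^sub>3 = \<phi>''(0)/2\<close>. Writing \<open>p\<close> through a Schwarz function \<open>\<zeta>\<psi>(\<zeta>)\<close> gives
  \<open>A\<^sub>3 - A\<^sub>2\<^sup>2 = (1 - \<alpha>) (\<psi>'(0) + (2\<alpha> - 1) \<psi>(0)\<^sup>2)\<close>, and \<open>\<bar>\<psi>'(0)\<bar> \<le> 1 - \<bar>\<psi>(0)\<bar>\<^sup>2\<close> by Schwarz--Pick.
  Equality holds for \<open>g(x) = (1 - T(x)\<^sup>2)\<^bsup>\<alpha> - 1\<^esup>\<close>, where the Hahn--Banach theorem provides the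
  functional \<open>T\<close>. That the higher derivatives of \<open>F\<close> exist follows from Cauchy estimates
  on complex lines, transferred to Banach space values by norming functionals.
\<close>

subsection \<open>Complex scalar multiplication\<close>

lemma bounded_linear_scaleC_right: "bounded_linear (\<lambda>x::'a::complex_normed_vector. c *\<^sub>C x)"
proof
  show "c *\<^sub>C (r *\<^sub>R x) = r *\<^sub>R (c *\<^sub>C x)" for r and x :: 'a
    by (simp add: scaleR_scaleC scaleC_scaleC mult.commute)
  show "\<exists>K. \<forall>x::'a. norm (c *\<^sub>C x) \<le> norm x * K"
    by (rule exI[of _ "cmod c"]) (simp add: norm_scaleC mult.commute)
qed (simp add: scaleC_add_right)

lemma bounded_bilinear_scaleC:
  "bounded_bilinear (\<lambda>c (x::'a::complex_normed_vector). c *\<^sub>C x)"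
proof
  show "(r *\<^sub>R c) *\<^sub>C x = r *\<^sub>R (c *\<^sub>C x)" for r c and x :: 'a
    by (simp add: scaleR_scaleC scaleC_scaleC scaleC_complex_def)
  show "c *\<^sub>C (r *\<^sub>R x) = r *\<^sub>R (c *\<^sub>C x)" for r c and x :: 'a
    by (simp add: scaleR_scaleC scaleC_scaleC mult.commute)
  show "\<exists>K. \<forall>c (x::'a). norm (c *\<^sub>C x) \<le> norm c * norm x * K"
    by (rule exI[of _ 1]) (simp add: norm_scaleC)
qed (simp_all add: scaleC_add_right scaleC_add_left)

lemmas scaleC_diff_left = bounded_bilinear.diff_left[OF bounded_bilinear_scaleC]
  and scaleC_diff_right = bounded_bilinear.diff_right[OF bounded_bilinear_scaleC]

lemma scaleC_one [simp]: "1 *\<^sub>C (x::'a::complex_normed_vector) = x"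
  using scaleR_scaleC[of 1 x] by simp

lemma scaleC_zero_left [simp]: "0 *\<^sub>C (x::'a::complex_normed_vector) = 0"
  using scaleR_scaleC[of 0 x] by simp

lemma scaleC_zero_right [simp]: "c *\<^sub>C (0::'a::complex_normed_vector) = 0"
  using norm_scaleC[of c "0::'a"] by simp

text \<open>
  The complex structure of the codomain alone makes the real operator space a complex one, so that
  \<open>fderiv f\<close> is again a map between complex normed spaces and theorems about \<open>fderiv\<close> can be
  iterated.
\<close>

instantiation blinfun :: (real_normed_vector, complex_normed_vector) complex_normed_vector
begin

lift_definition scaleC_blinfun :: "complex \<Rightarrow> 'a \<Rightarrow>\<^sub>L 'b \<Rightarrow> 'a \<Rightarrow>\<^sub>L 'b"
  is "\<lambda>c f x. c *\<^sub>C f x"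
  by (rule bounded_linear_compose[OF bounded_linear_scaleC_right])

instance
proof
  fix c d :: complex and f g :: "'a \<Rightarrow>\<^sub>L 'b" and r :: real
  show "c *\<^sub>C (f + g) = c *\<^sub>C f + c *\<^sub>C g"
    by transfer (simp add: scaleC_add_right)
  show "(c + d) *\<^sub>C f = c *\<^sub>C f + d *\<^sub>C f"
    by transfer (simp add: scaleC_add_left)
  show "c *\<^sub>C d *\<^sub>C f = (c * d) *\<^sub>C f"
    by transfer (simp add: scaleC_scaleC)
  show "r *\<^sub>R f = complex_of_real r *\<^sub>C f"
    by transfer (simp add: scaleR_scaleC)
  have le: "norm (c *\<^sub>C f) \<le> cmod c * norm f" for c and f :: "'a \<Rightarrow>\<^sub>L 'b"
    by (rule norm_blinfun_bound)
      (auto simp: scaleC_blinfun.rep_eq norm_scaleC mult.assoc intro!: mult_left_mono norm_blinfun)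
  show "norm (c *\<^sub>C f) = cmod c * norm f"
  proof (cases "c = 0")
    case True
    then show ?thesis using le[of 0 f] by simp
  next
    case False
    have "f = (1/c) *\<^sub>C c *\<^sub>C f"
      using False by transfer (simp add: scaleC_scaleC)
    then have "norm f \<le> cmod (1/c) * norm (c *\<^sub>C f)"
      by (metis le)
    then have "cmod c * norm f \<le> norm (c *\<^sub>C f)"
      using False by (simp add: norm_divide divide_simps mult.commute)
    with le[of c f] show ?thesis by simp
  qed
qed

end

instance blinfun :: (real_normed_vector, complex_banach) complex_banach ..

subsection \<open>The Hahn-Banach theorem\<close>

text \<open>The norm bound is part of the notion because, together with subadditivity, it forces
  \<open>- norm x \<le> p x\<close>, which keeps pointwise infima of such functionals
  finite.\<close>

definition sublinear_le_norm :: "('a::real_normed_vector \<Rightarrow> real) \<Rightarrow> bool"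
  where "sublinear_le_norm p \<longleftrightarrow> (\<forall>x y. p (x + y) \<le> p x + p y) \<and>
    (\<forall>r x. 0 < r \<longrightarrow> p (r *\<^sub>R x) = r * p x) \<and> (\<forall>x. p x \<le> norm x)"

lemma sublinear_le_normD:
  assumes "sublinear_le_norm p"
  shows "p (x + y) \<le> p x + p y" "0 < r \<Longrightarrow> p (r *\<^sub>R x) = r * p x" "p x \<le> norm x"
    "p 0 = 0" "- norm x \<le> p x"
proof -
  show 1: "p (x + y) \<le> p x + p y" "0 < r \<Longrightarrow> p (r *\<^sub>R x) = r * p x" "p x \<le> norm x" for x y r
    using assms by (auto simp: sublinear_le_norm_def)
  show 0: "p 0 = 0" using 1(2)[of 2 0] by simp
  show "- norm x \<le> p x" using 1(1)[of x "-x"] 1(3)[of "-x"] 0 by simp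
qed

text \<open>
  Decreases \<open>p\<close> as far as possible in direction \<open>-x\<close>: the result \<open>q\<close> satisfies
  \<open>q (-x) \<le> - p x\<close>.
\<close>

lemma sublinear_le_norm_shift:
  fixes p :: "'a::real_normed_vector \<Rightarrow> real" and x :: 'a
  assumes p: "sublinear_le_norm p"
  defines "q \<equiv> \<lambda>y. INF t\<in>{0..}. p (y + t *\<^sub>R x) - t * p x"
  shows "sublinear_le_norm q" "q y \<le> p y" "0 \<le> t \<Longrightarrow> q y \<le> p (y + t *\<^sub>R x) - t * p x"
proof -
  note P = sublinear_le_normD[OF p]
  have Ps: "p (t *\<^sub>R x) = t * p x" if "0 \<le> t" for t and x
    using that P(2)[of t x] P(4) by (cases "t = 0") auto
  \<comment> \<open>Subadditivity at \<open>t *\<^sub>R x = (y + t *\<^sub>R x) + (- y)\<close>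
    bounds the family from below, so its infimum is a genuine one.\<close>
  have low: "- norm y \<le> p (y + t *\<^sub>R x) - t * p x" if "0 \<le> t" for y t
    using P(1)[of "y + t *\<^sub>R x" "-y"] P(3)[of "-y"] Ps[OF that, of x] by simp
  then have bdd: "bdd_below ((\<lambda>t. p (y + t *\<^sub>R x) - t * p x) ` {0..})" for y
    by (auto intro!: bdd_belowI[of _ "- norm y"])
  show le: "q y \<le> p (y + t *\<^sub>R x) - t * p x" if "0 \<le> t" for y t
    unfolding q_def using that by (auto intro!: cINF_lower bdd)
  show leP: "q y \<le> p y" for y using le[of 0 y] by simp
  have ge: "m \<le> q y" if "\<And>t. 0 \<le> t \<Longrightarrow> m \<le> p (y + t *\<^sub>R x) - t * p x" for m y
    unfolding q_def using that by (auto intro!: cINF_greatest)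
  have add: "q (y + z) \<le> q y + q z" for y z
  proof -
    \<comment> \<open>The two infima are taken one at a time: the parameters \<open>t\<close> for
      \<open>y\<close> and \<open>s\<close> for \<open>z\<close> combine to the admissible parameter
      \<open>t + s\<close> for \<open>y + z\<close>.\<close>
    have "q (y + z) - (p (z + s *\<^sub>R x) - s * p x) \<le> q y" if s: "0 \<le> s" for s
    proof (rule ge)
      fix t :: real assume t: "0 \<le> t"
      show "q (y + z) - (p (z + s *\<^sub>R x) - s * p x) \<le> p (y + t *\<^sub>R x) - t * p x"
        using le[of "t + s" "y + z"] s t P(1)[of "y + t *\<^sub>R x" "z + s *\<^sub>R x"]
        by (simp add: algebra_simps)
    qed
    then have "q (y + z) - q y \<le> q z" by (intro ge) (simp add: algebra_simps)
    then show ?thesis by simp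
  qed
  have scale_le: "q (r *\<^sub>R y) \<le> r * q y" if r: "0 < r" for r y
  proof -
    have "q (r *\<^sub>R y) / r \<le> q y"
    proof (rule ge)
      fix t :: real assume t: "0 \<le> t"
      have "q (r *\<^sub>R y) \<le> p (r *\<^sub>R (y + t *\<^sub>R x)) - (r * t) * p x"
        using le[of "r * t" "r *\<^sub>R y"] r t by (simp add: algebra_simps)
      also have "\<dots> = r * (p (y + t *\<^sub>R x) - t * p x)"
        unfolding P(2)[OF r] by (simp add: algebra_simps)
      finally show "q (r *\<^sub>R y) / r \<le> p (y + t *\<^sub>R x) - t * p x"
        using r by (simp add: field_simps)
    qed
    then show ?thesis using r by (simp add: field_simps)
  qed
  have scale: "q (r *\<^sub>R y) = r * q y" if r: "0 < r" for r y
  proof (rule antisym)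
    show "r * q y \<le> q (r *\<^sub>R y)"
      using scale_le[of "1/r" "r *\<^sub>R y"] r by (simp add: field_simps)
  qed (rule scale_le[OF r])
  show "sublinear_le_norm q"
    unfolding sublinear_le_norm_def using add scale leP P(3) order_trans by blast
qed

text \<open>Provides the lower bounds of chains for Zorn's lemma. Subadditivity survives the infimum
  because, of two members of a chain, the smaller one lies below both and can replace both.\<close>

lemma sublinear_le_norm_Inf:
  fixes C :: "('a::real_normed_vector \<Rightarrow> real) set"
  assumes "C \<noteq> {}" and sub: "\<And>p. p \<in> C \<Longrightarrow> sublinear_le_norm p"
    and chain: "\<And>p q. p \<in> C \<Longrightarrow> q \<in> C \<Longrightarrow> p \<le> q \<or> q \<le> p"
  shows "sublinear_le_norm (\<lambda>x. INF p\<in>C. p x)" "p \<in> C \<Longrightarrow> (INF p\<in>C. p x) \<le> p x"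
proof -
  define q where "q = (\<lambda>x. INF p\<in>C. p x)"
  have bdd: "bdd_below ((\<lambda>p. p x) ` C)" for x
    using sublinear_le_normD(5)[OF sub] by (auto intro!: bdd_belowI[of _ "- norm x"])
  have le: "q x \<le> p x" if "p \<in> C" for p x
    unfolding q_def using that by (auto intro!: cINF_lower bdd)
  then show "p \<in> C \<Longrightarrow> (INF p\<in>C. p x) \<le> p x" unfolding q_def .
  have ge: "m \<le> q x" if "\<And>p. p \<in> C \<Longrightarrow> m \<le> p x" for m x
    unfolding q_def using that assms(1) by (auto intro!: cINF_greatest)
  have add: "q (x + y) \<le> q x + q y" for x y
  proof -
    have "q (x + y) - p' y \<le> q x" if p': "p' \<in> C" for p'
    proof (rule ge)
      fix p assume p: "p \<in> C"
      obtain r where r: "r \<in> C" "r \<le> p" "r \<le> p'"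
        using chain[OF p p'] p p' by blast
      then have "q (x + y) \<le> r x + r y"
        using le[OF r(1), of "x + y"] sublinear_le_normD(1)[OF sub[OF r(1)], of x y] by linarith
      then show "q (x + y) - p' y \<le> p x"
        using r le_funD[OF r(2), of x] le_funD[OF r(3), of y] by linarith
    qed
    then have "q (x + y) - q x \<le> q y" by (intro ge) (simp add: algebra_simps)
    then show ?thesis by simp
  qed
  have scale_le: "q (r *\<^sub>R y) \<le> r * q y" if r: "0 < r" for r y
  proof -
    have "q (r *\<^sub>R y) / r \<le> q y"
    proof (rule ge)
      fix p assume p: "p \<in> C"
      show "q (r *\<^sub>R y) / r \<le> p y"
        using le[OF p, of "r *\<^sub>R y"] sublinear_le_normD(2)[OF sub[OF p] r, of y] r
        by (simp add: field_simps)
    qed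
    then show ?thesis using r by (simp add: field_simps)
  qed
  have scale: "q (r *\<^sub>R y) = r * q y" if r: "0 < r" for r y
  proof (rule antisym)
    show "r * q y \<le> q (r *\<^sub>R y)"
      using scale_le[of "1/r" "r *\<^sub>R y"] r by (simp add: field_simps)
  qed (rule scale_le[OF r])
  obtain p0 where "p0 \<in> C" using assms(1) by blast
  then have "q x \<le> norm x" for x
    using le[of p0 x] sublinear_le_normD(3)[OF sub, of p0 x] by linarith
  then show "sublinear_le_norm (\<lambda>x. INF p\<in>C. p x)"
    using add scale unfolding sublinear_le_norm_def q_def by blast
qed

text \<open>A minimal sublinear functional is linear, since shifting cannot decrease it.\<close>

lemma exists_linear_below_sublinear:
  fixes p :: "'a::real_normed_vector \<Rightarrow> real"
  assumes p: "sublinear_le_norm p"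
  obtains f where "linear f" "f \<le> p"
proof -
  let ?A = "{q. sublinear_le_norm q \<and> q \<le> p}"
  \<comment> \<open>The order is reversed, so the maximal element delivered by Zorn's lemma is a
    minimal functional below \<open>p\<close>.\<close>
  have "\<exists>m\<in>?A. \<forall>a\<in>?A. m \<ge> a \<longrightarrow> a = m"
  proof (rule predicate_Zorn)
    show "partial_order_on ?A (relation_of (\<ge>) ?A)"
      by (auto simp: partial_order_on_def preorder_on_def refl_on_def trans_def antisym_def relation_of_def)
    fix C assume "C \<in> Chains (relation_of (\<ge>) ?A)"
    then have C: "C \<subseteq> ?A" "\<And>a b. a \<in> C \<Longrightarrow> b \<in> C \<Longrightarrow> a \<le> b \<or> b \<le> a"
      by (auto simp: Chains_def relation_of_def)
    show "\<exists>u\<in>?A. \<forall>a\<in>C. a \<ge> u"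
    proof (cases "C = {}")
      case True then show ?thesis using p by auto
    next
      case False
      then obtain c where c: "c \<in> C" by blast
      have sub: "sublinear_le_norm (\<lambda>x. INF q\<in>C. q x)"
        using C by (intro sublinear_le_norm_Inf False) auto
      have lower: "(\<lambda>x. INF q\<in>C. q x) \<le> a" if "a \<in> C" for a
        unfolding le_fun_def using C that by (intro allI sublinear_le_norm_Inf(2)) auto
      have "(\<lambda>x. INF q\<in>C. q x) \<in> ?A"
        using sub lower[OF c] C c by (auto intro: order_trans)
      with lower show ?thesis by blast
    qed
  qed
  then obtain m where m: "sublinear_le_norm m" "m \<le> p"
    and min: "\<And>a. sublinear_le_norm a \<Longrightarrow> a \<le> p \<Longrightarrow> a \<le> m \<Longrightarrow> a = m"
    by auto
  note M = sublinear_le_normD[OF m(1)]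
  have add: "m (y + x) = m y + m x" for x y
  proof -
    let ?q = "\<lambda>y. INF t\<in>{0..}. m (y + t *\<^sub>R x) - t * m x"
    \<comment> \<open>By minimality the shift of \<open>m\<close> along \<open>x\<close> is
      \<open>m\<close> itself; its defining bound at \<open>t = 1\<close> is then the missing half
      of additivity.\<close>
    have "?q \<le> m" unfolding le_fun_def using sublinear_le_norm_shift(2)[OF m(1)] by blast
    then have "?q = m"
      using sublinear_le_norm_shift(1)[OF m(1)] m(2) by (intro min) (auto intro: order_trans)
    moreover have "?q y \<le> m (y + 1 *\<^sub>R x) - 1 * m x"
      by (rule sublinear_le_norm_shift(3)[OF m(1)]) simp
    ultimately have "m y \<le> m (y + x) - m x" by (simp add: fun_eq_iff)
    with M(1)[of y x] show ?thesis by simp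
  qed
  have neg: "m (- x) = - m x" for x using add[of x "-x"] M(4) by simp
  have "linear m"
  proof
    show "m (r *\<^sub>R x) = r *\<^sub>R m x" for r x
      using M(2)[of r x] M(2)[of "-r" x] neg[of "r *\<^sub>R x"] M(4)
      by (cases r "0::real" rule: linorder_cases) auto
  qed (rule add)
  then show thesis using m(2) by (rule that)
qed

text \<open>A linear functional below the norm shifted along \<open>x\<close> satisfies
  \<open>f (- x) \<le> - norm x\<close>, and this forces \<open>f x = norm x\<close>.\<close>

lemma exists_real_support_functional:
  fixes x :: "'a::real_normed_vector"
  obtains f where "linear f" "\<And>y. \<bar>f y\<bar> \<le> norm y" "f x = norm x"
proof -
  have n: "sublinear_le_norm (norm :: 'a \<Rightarrow> real)"
    by (auto simp: sublinear_le_norm_def norm_triangle_ineq)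
  let ?q = "\<lambda>y. INF t\<in>{0..}. norm (y + t *\<^sub>R x) - t * norm x"
  obtain f where f: "linear f" "f \<le> ?q"
    using exists_linear_below_sublinear[OF sublinear_le_norm_shift(1)[OF n, of x]] by blast
  have le: "f y \<le> norm y" for y
    using le_funD[OF f(2)] sublinear_le_norm_shift(2)[OF n] by (rule order_trans)
  have "f (- x) \<le> norm (- x + 1 *\<^sub>R x) - 1 * norm x"
    using le_funD[OF f(2), of "- x"] sublinear_le_norm_shift(3)[OF n, of 1 "-x" x] by linarith
  then have "f x = norm x" using le[of x] linear_neg[OF f(1), of x] by simp
  moreover have "\<bar>f y\<bar> \<le> norm y" for y
    using le[of y] le[of "- y"] linear_neg[OF f(1), of y] by simp
  ultimately show thesis using f(1) that by blast
qed

text \<open>A real norming functional \<open>f\<close> is complexified by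
  \<open>T y = f y - i f (i y)\<close>, which is complex linear with real part
  \<open>f\<close>.\<close>

lemma support_functional_exists:
  fixes x :: "'a::complex_normed_vector"
  assumes "x \<noteq> 0"
  shows "support_functionals x \<noteq> {}"
proof -
  obtain f where f: "linear f" "\<And>y. \<bar>f y\<bar> \<le> norm y" "f x = norm x"
    using exists_real_support_functional by blast
  interpret linear f by (rule f(1))
  define T where "T = (\<lambda>y. Complex (f y) (- f (\<i> *\<^sub>C y)))"
  have Tadd: "T (y + z) = T y + T z" for y z
    by (simp add: T_def scaleC_add_right add complex_eq_iff)
  have fi: "f ((\<i> * c) *\<^sub>C y) = Re c * f (\<i> *\<^sub>C y) - Im c * f y"
    and f1: "f (c *\<^sub>C y) = Re c * f y + Im c * f (\<i> *\<^sub>C y)" for c y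
  proof -
    have s: "f (c *\<^sub>C y) = Re c * f y + Im c * f (\<i> *\<^sub>C y)" for c y
    proof -
      have "c *\<^sub>C y = Re c *\<^sub>R y + Im c *\<^sub>R (\<i> *\<^sub>C y)"
        unfolding scaleR_scaleC scaleC_scaleC scaleC_add_left[symmetric]
        by (metis complex_eq mult.commute)
      then show ?thesis by (simp add: add scale)
    qed
    show "f (c *\<^sub>C y) = Re c * f y + Im c * f (\<i> *\<^sub>C y)" by (rule s)
    show "f ((\<i> * c) *\<^sub>C y) = Re c * f (\<i> *\<^sub>C y) - Im c * f y" by (subst s) simp
  qed
  have Tscale: "T (c *\<^sub>C y) = c * T y" for c y
  proof -
    have "T (c *\<^sub>C y) = Complex (f (c *\<^sub>C y)) (- f ((\<i> * c) *\<^sub>C y))"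
      by (simp add: T_def scaleC_scaleC)
    also have "\<dots> = c * T y"
      unfolding f1[of c y] fi[of c y] by (simp add: T_def complex_eq_iff)
    finally show ?thesis .
  qed
  have Tle: "cmod (T y) \<le> norm y" for y
  proof (cases "T y = 0")
    case False
    \<comment> \<open>The unimodular factor \<open>c\<close> rotates \<open>T y\<close> onto the
      positive real axis, where \<open>T\<close> agrees with its real part \<open>f\<close>.\<close>
    define c where "c = cnj (T y) / cmod (T y)"
    have c1: "cmod c = 1" using False by (simp add: c_def norm_divide)
    have "c * T y = complex_of_real (cmod (T y))"
      using False by (simp add: c_def complex_norm_square[symmetric] mult.commute power2_eq_square)
    then have "cmod (T y) = Re (T (c *\<^sub>C y))" by (simp add: Tscale)
    also have "\<dots> = f (c *\<^sub>C y)" by (simp add: T_def)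
    also have "\<dots> \<le> norm y" using f(2)[of "c *\<^sub>C y"] c1 by (simp add: norm_scaleC)
    finally show ?thesis .
  qed simp
  have Tbl: "bounded_linear T"
  proof
    show "T (r *\<^sub>R y) = r *\<^sub>R T y" for r y
      by (simp add: scaleR_scaleC Tscale scaleC_complex_def)
    show "\<exists>K. \<forall>y. cmod (T y) \<le> norm y * K" by (rule exI[of _ 1]) (simp add: Tle)
  qed (rule Tadd)
  \<comment> \<open>Since \<open>Re (T x) = norm x\<close> already exhausts the bound
    \<open>cmod (T x) \<le> norm x\<close>, the imaginary part vanishes.\<close>
  have "f x \<le> cmod (T x)" using complex_Re_le_cmod[of "T x"] by (simp add: T_def)
  then have "cmod (T x) = Re (T x)" using Tle[of x] f(3) by (simp add: T_def)
  then have Tx: "T x = complex_of_real (norm x)"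
    using f(3) Tle[of x] cmod_power2[of "T x"] by (simp add: T_def complex_eq_iff)
  have "norm (Blinfun T) = 1"
    by (rule norm_blinfun_eqI[of _ _ x]) (use assms Tx Tle in \<open>auto simp: bounded_linear_Blinfun_apply[OF Tbl]\<close>)
  then have "Blinfun T \<in> support_functionals x"
    using Tx Tscale Tbl
    by (simp add: support_functionals_def bounded_clinear_def bounded_linear_Blinfun_apply[OF Tbl] scaleC_complex_def)
  then show ?thesis by blast
qed

subsection \<open>Holomorphic maps between complex Banach spaces\<close>

lemma bounded_clinearD:
  assumes "bounded_clinear f"
  shows "bounded_linear f" "f (c *\<^sub>C x) = c *\<^sub>C f x"
  using assms by (auto simp: bounded_clinear_def)

lemma fderiv_eqI:
  assumes "(f has_derivative blinfun_apply D) (at x)"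
  shows "fderiv f x = D"
  unfolding fderiv_def frechet_derivative_at[OF assms, symmetric] by (rule blinfun_apply_inverse)

lemma frechet_holomorphic_onD:
  assumes "frechet_holomorphic_on f S" "x \<in> S"
  shows "(f has_derivative blinfun_apply (fderiv f x)) (at x)"
    "fderiv f x (c *\<^sub>C h) = c *\<^sub>C fderiv f x h"
    "bounded_clinear (blinfun_apply (fderiv f x))"
proof -
  obtain D where D: "bounded_clinear D" "(f has_derivative D) (at x)"
    using assms by (auto simp: frechet_holomorphic_on_def)
  have e: "blinfun_apply (Blinfun D) = D"
    by (rule bounded_linear_Blinfun_apply[OF bounded_clinearD(1)[OF D(1)]])
  then have "fderiv f x = Blinfun D" using D(2) by (intro fderiv_eqI) simp
  with D e show "(f has_derivative blinfun_apply (fderiv f x)) (at x)"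
    "fderiv f x (c *\<^sub>C h) = c *\<^sub>C fderiv f x h" "bounded_clinear (blinfun_apply (fderiv f x))"
    by (auto simp: bounded_clinearD)
qed

lemma frechet_holomorphic_on_subset:
  assumes "frechet_holomorphic_on f S" "open U" "U \<subseteq> S"
  shows "frechet_holomorphic_on f U"
  using assms by (auto simp: frechet_holomorphic_on_def)

lemma frechet_holomorphic_on_diff:
  assumes "frechet_holomorphic_on f S" "frechet_holomorphic_on g S"
  shows "frechet_holomorphic_on (\<lambda>x. f x - g x) S"
    "x \<in> S \<Longrightarrow> fderiv (\<lambda>x. f x - g x) x = fderiv f x - fderiv g x"
proof -
  have 1: "((\<lambda>x. f x - g x) has_derivative blinfun_apply (fderiv f x - fderiv g x)) (at x)" if "x \<in> S" for x
    using has_derivative_diff[OF frechet_holomorphic_onD(1)[OF assms(1) that]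
        frechet_holomorphic_onD(1)[OF assms(2) that]]
    by (simp add: minus_blinfun.rep_eq)
  then show "x \<in> S \<Longrightarrow> fderiv (\<lambda>x. f x - g x) x = fderiv f x - fderiv g x"
    by (rule fderiv_eqI)
  have "bounded_clinear (blinfun_apply (fderiv f x - fderiv g x))" if "x \<in> S" for x
    unfolding bounded_clinear_def
    using frechet_holomorphic_onD(2)[OF assms(1) that] frechet_holomorphic_onD(2)[OF assms(2) that]
    by (auto simp: blinfun.bounded_linear_right blinfun.diff_left bounded_linear.linear
        linear_diff[OF bounded_linear.linear[OF bounded_linear_scaleC_right]])
  then show "frechet_holomorphic_on (\<lambda>x. f x - g x) S"
    using 1 assms(1) by (auto simp: frechet_holomorphic_on_def)
qed

text \<open>Reduction to one variable: complex linearity of the derivative and of \<open>T\<close>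
  turns the real derivative of the composite into multiplication by a complex number.\<close>

lemma has_field_derivative_along_line:
  assumes f: "frechet_holomorphic_on f S" and T: "bounded_clinear (blinfun_apply T)"
    and "a + \<zeta> *\<^sub>C h \<in> S"
  shows "((\<lambda>\<zeta>. blinfun_apply T (f (a + \<zeta> *\<^sub>C h))) has_field_derivative
    blinfun_apply T (fderiv f (a + \<zeta> *\<^sub>C h) h)) (at \<zeta>)"
proof -
  have 1: "((\<lambda>\<zeta>. a + \<zeta> *\<^sub>C h) has_derivative (\<lambda>\<zeta>. \<zeta> *\<^sub>C h)) (at \<zeta>)"
    by (auto intro!: derivative_eq_intros
        bounded_linear_imp_has_derivative bounded_bilinear.bounded_linear_left[OF bounded_bilinear_scaleC])
  have "((\<lambda>\<zeta>. f (a + \<zeta> *\<^sub>C h)) has_derivative (\<lambda>\<zeta>'. fderiv f (a + \<zeta> *\<^sub>C h) (\<zeta>' *\<^sub>C h))) (at \<zeta>)"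
    by (rule has_derivative_compose[OF 1 frechet_holomorphic_onD(1)[OF f assms(3)]])
  then have "((\<lambda>\<zeta>. blinfun_apply T (f (a + \<zeta> *\<^sub>C h))) has_derivative
      (\<lambda>\<zeta>'. blinfun_apply T (fderiv f (a + \<zeta> *\<^sub>C h) (\<zeta>' *\<^sub>C h)))) (at \<zeta>)"
    by (rule bounded_linear.has_derivative[OF blinfun.bounded_linear_right])
  moreover have "(\<lambda>\<zeta>'. blinfun_apply T (fderiv f (a + \<zeta> *\<^sub>C h) (\<zeta>' *\<^sub>C h))) =
      (*) (blinfun_apply T (fderiv f (a + \<zeta> *\<^sub>C h) h))"
    by (auto simp: fun_eq_iff frechet_holomorphic_onD(2)[OF f assms(3)] bounded_clinearD(2)[OF T] scaleC_complex_def)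
  ultimately show ?thesis by (simp add: has_field_derivative_def)
qed

text \<open>Lifts scalar estimates to vector values, since a support functional at \<open>y\<close>
  satisfies \<open>T y = norm y\<close>. The bound \<open>0 \<le> B\<close> settles
  \<open>y = 0\<close>.\<close>

lemma norm_le_if_functionals_le:
  fixes y :: "'a::complex_normed_vector"
  assumes "0 \<le> B"
    and "\<And>T :: 'a \<Rightarrow>\<^sub>L complex. bounded_clinear (blinfun_apply T) \<Longrightarrow> norm T = 1 \<Longrightarrow> cmod (T y) \<le> B"
  shows "norm y \<le> B"
proof (cases "y = 0")
  case False
  then obtain T where "T \<in> support_functionals y" using support_functional_exists by blast
  then show ?thesis using assms(2)[of T] by (simp add: support_functionals_def)
qed (use assms in simp)

section \<open>Cauchy estimates on discs and balls\<close>

lemma deriv_bound_disc: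
  assumes u: "u holomorphic_on ball 0 \<rho>" and "0 < \<rho>" and M: "\<And>\<zeta>. cmod \<zeta> < \<rho> \<Longrightarrow> cmod (u \<zeta>) \<le> M"
  shows "cmod (deriv u 0) \<le> 2 * M / \<rho>"
proof -
  \<comment> \<open>The circle of radius \<open>\<rho>/2\<close> keeps a closed disc inside the
    domain and accounts for the factor 2.\<close>
  have "cmod ((deriv ^^ 1) u 0) \<le> fact 1 * M / (\<rho>/2) ^ 1"
    using \<open>0 < \<rho>\<close> M
    by (intro Cauchy_inequality holomorphic_on_imp_continuous_on holomorphic_on_subset[OF u]) auto
  then show ?thesis by (simp add: mult.commute)
qed

text \<open>Taylor's formula with Cauchy's bound \<open>2 * M / (\<rho>/2)\<^sup>2\<close> for the
  second derivative. The condition \<open>2 < \<rho>\<close> puts the disc of radius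
  \<open>\<rho>/2\<close> about each point of the closed unit disc inside the domain.\<close>

lemma linear_remainder_bound_disc:
  assumes u: "u holomorphic_on ball 0 \<rho>" and \<rho>: "2 < \<rho>" and M: "\<And>\<zeta>. cmod \<zeta> < \<rho> \<Longrightarrow> cmod (u \<zeta>) \<le> M"
  shows "cmod (u 1 - u 0 - deriv u 0) \<le> 8 * M / \<rho>\<^sup>2"
proof -
  let ?S = "cball (0::complex) 1"
  let ?f = "\<lambda>i. (deriv ^^ i) u"
  have sub: "cball x (\<rho>/2) \<subseteq> ball 0 \<rho>" if "x \<in> ?S" for x
  proof
    fix y assume "y \<in> cball x (\<rho>/2)"
    then show "y \<in> ball 0 \<rho>"
      using that \<rho> norm_triangle_ineq4[of x "x - y"] by (simp add: dist_norm)
  qed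
  have "cmod (?f 0 1 - (\<Sum>i\<le>1. ?f i 0 * (1 - 0) ^ i / fact i))
      \<le> (8 * M / \<rho>\<^sup>2) * cmod (1 - 0) ^ Suc 1 / fact 1"
  proof (rule complex_Taylor[of ?S])
    fix i :: nat and x assume x: "x \<in> ?S"
    have "(deriv ^^ i) u holomorphic_on ball 0 \<rho>"
      using u by (rule holomorphic_higher_deriv) simp
    then show "(?f i has_field_derivative ?f (Suc i) x) (at x within ?S)"
      using x \<rho> by (auto intro!: has_field_derivative_at_within[OF holomorphic_derivI])
    have "cmod ((deriv ^^ 2) u x) \<le> fact 2 * M / (\<rho>/2) ^ 2"
    proof (rule Cauchy_inequality)
      show "u holomorphic_on ball x (\<rho>/2)"
        using sub[OF x] ball_subset_cball by (blast intro: holomorphic_on_subset[OF u])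
      show "continuous_on (cball x (\<rho>/2)) u"
        using sub[OF x] by (blast intro: holomorphic_on_imp_continuous_on holomorphic_on_subset[OF u])
      show "cmod (u y) \<le> M" if "cmod (x - y) = \<rho>/2" for y
        using sub[OF x] that by (intro M) (auto simp: dist_norm subset_iff)
    qed (use \<rho> in simp)
    then show "cmod (?f (Suc 1) x) \<le> 8 * M / \<rho>\<^sup>2"
      by (simp add: numeral_2_eq_2 power_divide)
  qed auto
  then show ?thesis by (simp add: algebra_simps)
qed

text \<open>Along \<open>a + \<zeta> *\<^sub>C h\<close> the ball corresponds to the disc of radius
  \<open>r / norm h\<close>. The one-variable bounds with this radius produce the powers of
  \<open>norm h\<close>, and norming functionals carry them over to \<open>'b\<close>.\<close>

lemma frechet_holomorphic_bounds:
  fixes f :: "'a::complex_normed_vector \<Rightarrow> 'b::complex_normed_vector"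
  assumes f: "frechet_holomorphic_on f (ball a r)" and r: "0 < r"
    and M: "\<And>x. x \<in> ball a r \<Longrightarrow> norm (f x) \<le> M"
  shows "norm (fderiv f a h) \<le> 2 * M / r * norm h"
    "2 * norm h < r \<Longrightarrow> norm (f (a + h) - f a - fderiv f a h) \<le> 8 * M / r\<^sup>2 * (norm h)\<^sup>2"
proof -
  have "0 \<le> M" using M[of a] r norm_ge_zero[of "f a"] by (simp del: norm_ge_zero)
  let ?u = "\<lambda>T \<zeta>. blinfun_apply (T :: 'b \<Rightarrow>\<^sub>L complex) (f (a + \<zeta> *\<^sub>C h))"
  have mem: "a + \<zeta> *\<^sub>C h \<in> ball a r" if "h \<noteq> 0" "cmod \<zeta> < r / norm h" for \<zeta>
    using that by (simp add: dist_norm norm_scaleC field_simps)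
  have der: "(?u T has_field_derivative T (fderiv f (a + \<zeta> *\<^sub>C h) h)) (at \<zeta>)"
    if "bounded_clinear (blinfun_apply T)" "h \<noteq> 0" "cmod \<zeta> < r / norm h" for T \<zeta>
    using has_field_derivative_along_line[OF f that(1) mem[OF that(2,3)]] .
  have hol: "?u T holomorphic_on ball 0 (r / norm h)" if "bounded_clinear (blinfun_apply T)" "h \<noteq> 0" for T
    unfolding holomorphic_on_open[OF open_ball] by (intro ballI exI, rule der[OF that]) simp
  have bd: "cmod (?u T \<zeta>) \<le> M" if "norm T = 1" "h \<noteq> 0" "cmod \<zeta> < r / norm h" for T \<zeta>
    using norm_blinfun[of T "f (a + \<zeta> *\<^sub>C h)"] M[OF mem[OF that(2,3)]] that(1) by simp
  have d0: "deriv (?u T) 0 = T (fderiv f a h)" if "bounded_clinear (blinfun_apply T)" "h \<noteq> 0" for T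
    using DERIV_imp_deriv[OF der[OF that, of 0]] that(2) r by simp
  show "norm (fderiv f a h) \<le> 2 * M / r * norm h"
  proof (cases "h = 0")
    case False
    show ?thesis
    proof (rule norm_le_if_functionals_le)
      fix T :: "'b \<Rightarrow>\<^sub>L complex" assume T: "bounded_clinear (blinfun_apply T)" "norm T = 1"
      show "cmod (T (fderiv f a h)) \<le> 2 * M / r * norm h"
        using deriv_bound_disc[OF hol[OF T(1) False] _ bd[OF T(2) False]] d0[OF T(1) False] False r
        by simp
    qed (use \<open>0 \<le> M\<close> r in simp)
  qed (simp add: blinfun.zero_right)
  show "norm (f (a + h) - f a - fderiv f a h) \<le> 8 * M / r\<^sup>2 * (norm h)\<^sup>2" if h: "2 * norm h < r"
  proof (cases "h = 0")
    case False
    show ?thesis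
    proof (rule norm_le_if_functionals_le)
      fix T :: "'b \<Rightarrow>\<^sub>L complex" assume T: "bounded_clinear (blinfun_apply T)" "norm T = 1"
      have "2 < r / norm h" using h False by (simp add: field_simps)
      from linear_remainder_bound_disc[OF hol[OF T(1) False] this bd[OF T(2) False]]
      show "cmod (T (f (a + h) - f a - fderiv f a h)) \<le> 8 * M / r\<^sup>2 * (norm h)\<^sup>2"
        using d0[OF T(1) False] by (simp add: blinfun.diff_right power_divide)
    qed (use \<open>0 \<le> M\<close> r in simp)
  qed (simp add: blinfun.zero_right)
qed

lemma frechet_holomorphic_locally_bounded:
  fixes f :: "'a::complex_normed_vector \<Rightarrow> 'b::complex_normed_vector"
  assumes f: "frechet_holomorphic_on f S" and "a \<in> S"
  obtains r M where "0 < r" "0 \<le> M" "ball a r \<subseteq> S" "\<And>x. x \<in> ball a r \<Longrightarrow> norm (f x) \<le> M"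
proof -
  have "isCont f a"
    using frechet_holomorphic_onD(1)[OF assms] by (rule has_derivative_continuous)
  then obtain d where d: "0 < d" "\<And>x. dist x a < d \<Longrightarrow> dist (f x) (f a) < 1"
    unfolding continuous_at by (metis LIM_def zero_less_one dist_self isCont_def continuous_at)
  obtain e where e: "0 < e" "ball a e \<subseteq> S"
    using f \<open>a \<in> S\<close> by (auto simp: frechet_holomorphic_on_def open_contains_ball)
  show thesis
  proof (rule that[of "min d e" "norm (f a) + 1"])
    fix x assume "x \<in> ball a (min d e)"
    then have "dist (f x) (f a) < 1" using d(2)[of x] by (simp add: dist_commute)
    then show "norm (f x) \<le> norm (f a) + 1"
      using norm_triangle_ineq2[of "f x" "f a"] by (simp add: dist_norm)
  qed (use d e in auto)
qed

section \<open>Uniform limits and holomorphy of the derivative\<close>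

lemma has_derivative_if_quadratic_remainder:
  fixes f :: "'a::real_normed_vector \<Rightarrow> 'b::real_normed_vector"
  assumes L: "bounded_linear L" and r: "0 < r"
    and C: "\<And>h. norm h < r \<Longrightarrow> norm (f (a + h) - f a - L h) \<le> C * (norm h)\<^sup>2"
  shows "(f has_derivative L) (at a)"
  unfolding has_derivative_at
proof
  have "((\<lambda>h::'a. C * norm h) \<longlongrightarrow> C * norm (0::'a)) (at 0)"
    by (intro tendsto_intros)
  then have lim: "((\<lambda>h::'a. C * norm h) \<longlongrightarrow> 0) (at 0)" by simp
  show "((\<lambda>h. norm (f (a + h) - f a - L h) / norm h) \<longlongrightarrow> 0) (at 0)"
  proof (rule tendsto_sandwich[OF _ _ tendsto_const lim])
    have "\<forall>\<^sub>F h in at 0. h \<in> ball (0::'a) r - {0}"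
      using r by (intro eventually_at_in_open) auto
    then show "\<forall>\<^sub>F h in at 0. norm (f (a + h) - f a - L h) / norm h \<le> C * norm h"
    proof eventually_elim
      case (elim h)
      then show ?case using C[of h] by (simp add: field_simps power2_eq_square)
    qed
  qed simp
qed (rule L)

text \<open>Cauchy estimates for \<open>f m - f n\<close> make the derivatives Cauchy in operator
  norm, so they converge by completeness. The quadratic remainder bound, uniform in large
  \<open>n\<close>, then passes to the limit.\<close>

proposition uniform_limit_frechet_holomorphic:
  fixes f :: "nat \<Rightarrow> 'a::complex_normed_vector \<Rightarrow> 'b::complex_banach"
  assumes "open S" and f: "\<And>n. frechet_holomorphic_on (f n) S"
    and lim: "uniform_limit S f \<phi> sequentially"
  shows "frechet_holomorphic_on \<phi> S"
  unfolding frechet_holomorphic_on_def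
proof (intro conjI ballI \<open>open S\<close>)
  fix a assume a: "a \<in> S"
  have unif: "\<exists>N. \<forall>n\<ge>N. \<forall>x\<in>S. norm (f n x - \<phi> x) < e" if "0 < e" for e
    using lim that unfolding uniform_limit_iff eventually_sequentially dist_norm by blast
  obtain N where N: "\<And>n x. N \<le> n \<Longrightarrow> x \<in> S \<Longrightarrow> norm (f n x - \<phi> x) < 1"
    using unif[of 1] by auto
  obtain r K where rK: "0 < r" "0 \<le> K" "ball a r \<subseteq> S" "\<And>x. x \<in> ball a r \<Longrightarrow> norm (f N x) \<le> K"
    using frechet_holomorphic_locally_bounded[OF f a] by metis
  \<comment> \<open>Uniform closeness to \<open>\<phi>\<close> costs 1 for \<open>f n\<close> and 1
    for \<open>f N\<close>, hence \<open>K + 2\<close> bounds the whole tail.\<close>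
  have bd: "norm (f n x) \<le> K + 2" if "N \<le> n" "x \<in> ball a r" for n x
  proof -
    have "x \<in> S" using that rK by auto
    have "norm (f n x) = norm ((f n x - \<phi> x) - (f N x - \<phi> x) + f N x)" by simp
    also have "\<dots> \<le> norm (f n x - \<phi> x) + norm (f N x - \<phi> x) + norm (f N x)"
      by (meson norm_triangle_ineq norm_triangle_ineq4 order_trans add_mono order_refl)
    finally show ?thesis using N[OF that(1) \<open>x \<in> S\<close>] N[OF order_refl \<open>x \<in> S\<close>] rK(4)[OF that(2)] by simp
  qed
  have fr: "frechet_holomorphic_on (f n) (ball a r)" for n
    using f rK by (auto intro: frechet_holomorphic_on_subset)
  let ?L = "\<lambda>n. fderiv (f n) a"
  have "Cauchy ?L"
  proof (rule metric_CauchyI)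
    fix e :: real assume e: "0 < e"
    \<comment> \<open>Chosen so that the derivative estimate for a difference bounded by
      \<open>2 * e'\<close> comes out as \<open>e / 2\<close>.\<close>
    define e' where "e' = e * r / 8"
    have "0 < e'" using e rK by (simp add: e'_def)
    then obtain N' where N': "\<And>n x. N' \<le> n \<Longrightarrow> x \<in> S \<Longrightarrow> norm (f n x - \<phi> x) < e'"
      using unif by blast
    have "dist (?L m) (?L n) < e" if "N' \<le> m" "N' \<le> n" for m n
    proof -
      have d: "norm (f m x - f n x) \<le> 2 * e'" if "x \<in> ball a r" for x
        using N'[OF \<open>N' \<le> m\<close>, of x] N'[OF \<open>N' \<le> n\<close>, of x] that rK(3)
          norm_triangle_ineq4[of "f m x - \<phi> x" "f n x - \<phi> x"] by auto
      have "norm (?L m - ?L n) \<le> 2 * (2 * e') / r"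
      proof (rule norm_blinfun_bound)
        show "0 \<le> 2 * (2 * e') / r" using \<open>0 < e'\<close> rK by simp
        show "norm ((?L m - ?L n) h) \<le> 2 * (2 * e') / r * norm h" for h
          using frechet_holomorphic_bounds(1)[OF frechet_holomorphic_on_diff(1)[OF fr fr] rK(1) d]
            frechet_holomorphic_on_diff(2)[OF fr fr] rK(1) by simp
      qed
      also have "\<dots> = e / 2" using rK by (simp add: e'_def)
      finally show ?thesis using e by (simp add: dist_norm)
    qed
    then show "\<exists>N'. \<forall>m\<ge>N'. \<forall>n\<ge>N'. dist (?L m) (?L n) < e" by blast
  qed
  then obtain L where L: "?L \<longlonglongrightarrow> L" using Cauchy_convergent convergent_def by blast
  have Lh: "(\<lambda>n. ?L n h) \<longlonglongrightarrow> L h" for h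
    by (intro blinfun.tendsto L tendsto_const)
  have \<phi>: "(\<lambda>n. f n x) \<longlonglongrightarrow> \<phi> x" if "x \<in> S" for x
    using lim that by (rule tendsto_uniform_limitI)
  have "L (c *\<^sub>C h) = c *\<^sub>C L h" for c h
  proof (rule LIMSEQ_unique[OF Lh])
    show "(\<lambda>n. ?L n (c *\<^sub>C h)) \<longlonglongrightarrow> c *\<^sub>C L h"
      unfolding frechet_holomorphic_onD(2)[OF f a]
      by (rule bounded_linear.tendsto[OF bounded_linear_scaleC_right Lh])
  qed
  then have "bounded_clinear (blinfun_apply L)"
    by (simp add: bounded_clinear_def blinfun.bounded_linear_right)
  moreover have "(\<phi> has_derivative blinfun_apply L) (at a)"
  proof (rule has_derivative_if_quadratic_remainder)
    fix h :: 'a assume h: "norm h < r / 2"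
    then have m: "a + h \<in> S" using rK(1,3) by (auto simp: dist_norm subset_iff)
    show "norm (\<phi> (a + h) - \<phi> a - L h) \<le> 8 * (K + 2) / r\<^sup>2 * (norm h)\<^sup>2"
    proof (rule tendsto_upperbound)
      show "(\<lambda>n. norm (f n (a + h) - f n a - ?L n h)) \<longlonglongrightarrow> norm (\<phi> (a + h) - \<phi> a - L h)"
        by (intro tendsto_intros \<phi> Lh m a)
      show "\<forall>\<^sub>F n in sequentially. norm (f n (a + h) - f n a - ?L n h) \<le> 8 * (K + 2) / r\<^sup>2 * (norm h)\<^sup>2"
        using eventually_ge_at_top[of N]
      proof eventually_elim
        case (elim n)
        show ?case
          by (rule frechet_holomorphic_bounds(2)[OF fr rK(1) bd[OF elim]]) (use h in auto)
      qed
    qed simp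
  qed (use rK blinfun.bounded_linear_right in auto)
  ultimately show "\<exists>D. bounded_clinear D \<and> (\<phi> has_derivative D) (at a)" by blast
qed

lemma frechet_holomorphic_on_translate:
  assumes "frechet_holomorphic_on f S" "open U" "\<And>x. x \<in> U \<Longrightarrow> x + b \<in> S"
  shows "frechet_holomorphic_on (\<lambda>x. f (x + b)) U"
  unfolding frechet_holomorphic_on_def
proof (intro conjI ballI assms(2))
  fix x assume "x \<in> U"
  then have "x + b \<in> S" by (rule assms(3))
  have "((\<lambda>x. x + b) has_derivative (\<lambda>h. h)) (at x)" by (auto intro!: derivative_eq_intros)
  from has_derivative_compose[OF this frechet_holomorphic_onD(1)[OF assms(1) \<open>x + b \<in> S\<close>]]
    frechet_holomorphic_onD(3)[OF assms(1) \<open>x + b \<in> S\<close>]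
  show "\<exists>D. bounded_clinear D \<and> ((\<lambda>x. f (x + b)) has_derivative D) (at x)" by blast
qed

lemma frechet_holomorphic_on_scaleR:
  assumes "frechet_holomorphic_on f S"
  shows "frechet_holomorphic_on (\<lambda>x. c *\<^sub>R f x) S"
  unfolding frechet_holomorphic_on_def
proof (intro conjI ballI)
  show "open S" using assms by (simp add: frechet_holomorphic_on_def)
  fix x assume x: "x \<in> S"
  have "((\<lambda>x. c *\<^sub>R f x) has_derivative (\<lambda>h. c *\<^sub>R fderiv f x h)) (at x)"
    by (intro derivative_intros frechet_holomorphic_onD(1)[OF assms x])
  moreover have "bounded_clinear (\<lambda>h. c *\<^sub>R fderiv f x h)"
    unfolding bounded_clinear_def using frechet_holomorphic_onD(2)[OF assms x]
    by (simp add: bounded_linear_intros) (simp add: scaleR_scaleC scaleC_scaleC mult.commute)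
  ultimately show "\<exists>D. bounded_clinear D \<and> ((\<lambda>x. c *\<^sub>R f x) has_derivative D) (at x)" by blast
qed

text \<open>A directional derivative is a locally uniform limit of difference quotients.\<close>

lemma frechet_holomorphic_on_directional_derivative:
  fixes f :: "'a::complex_normed_vector \<Rightarrow> 'b::complex_banach"
  assumes f: "frechet_holomorphic_on f S"
  shows "frechet_holomorphic_on (\<lambda>x. fderiv f x h) S"
  unfolding frechet_holomorphic_on_def
proof (intro conjI ballI)
  show "open S" using f by (simp add: frechet_holomorphic_on_def)
  fix a assume a: "a \<in> S"
  obtain r M where rM: "0 < r" "0 \<le> M" "ball a r \<subseteq> S" "\<And>x. x \<in> ball a r \<Longrightarrow> norm (f x) \<le> M"
    using frechet_holomorphic_locally_bounded[OF f a] by metis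
  obtain N :: nat where N: "4 * norm h / r < real N" using reals_Archimedean2 by blast
  then have N0: "0 < real N" using rM by (meson divide_nonneg_pos dual_order.strict_trans2 mult_nonneg_nonneg norm_ge_zero zero_le_numeral)
  \<comment> \<open>The offset \<open>N\<close> makes every step \<open>t n *\<^sub>R h\<close>
    shorter than \<open>r/4\<close>, so already from \<open>n = 0\<close> on the translates stay in
    \<open>ball a r\<close> and the remainder bound on \<open>ball x (r/2)\<close> applies.\<close>
  define t where "t = (\<lambda>n. 1 / real (n + N))"
  have t0: "0 < t n" for n using N0 by (simp add: t_def)
  have th: "norm (t n *\<^sub>R h) < r / 4" for n
  proof -
    have "norm h < r / 4 * real N" using N rM by (simp add: field_simps)
    also have "\<dots> \<le> r / 4 * real (n + N)" using rM by (intro mult_left_mono) auto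
    finally show ?thesis using N0 by (simp add: t_def field_simps)
  qed
  define U where "U = ball a (r/2)"
  have sub: "ball x (r/2) \<subseteq> ball a r" if "x \<in> U" for x
  proof
    fix y assume "y \<in> ball x (r/2)"
    then show "y \<in> ball a r" using that dist_triangle[of a y x] by (simp add: U_def)
  qed
  have fr: "frechet_holomorphic_on f (ball x (r/2))" if "x \<in> U" for x
    using sub[OF that] rM(3) by (intro frechet_holomorphic_on_subset[OF f]) auto
  define q where "q = (\<lambda>n x. (1 / t n) *\<^sub>R (f (x + t n *\<^sub>R h) - f x))"
  have "frechet_holomorphic_on (\<lambda>x. fderiv f x h) U"
  proof (rule uniform_limit_frechet_holomorphic)
    show "open U" by (simp add: U_def)
    show "frechet_holomorphic_on (q n) U" for n
      unfolding q_def
    proof (intro frechet_holomorphic_on_scaleR frechet_holomorphic_on_diff(1) frechet_holomorphic_on_translate[OF f])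
      show "frechet_holomorphic_on f U"
        using rM sub by (intro frechet_holomorphic_on_subset[OF f]) (auto simp: U_def)
      fix x assume "x \<in> U"
      then have "x + t n *\<^sub>R h \<in> ball a r"
        using th[of n] sub[of x] rM(1) by (auto simp: subset_iff dist_norm)
      then show "x + t n *\<^sub>R h \<in> S" using rM(3) by blast
    qed (simp add: U_def)
    show "uniform_limit U q (\<lambda>x. fderiv f x h) sequentially"
    proof (rule uniform_limitI)
      fix e :: real assume e: "0 < e"
      define C where "C = 8 * M / (r/2)\<^sup>2 * (norm h)\<^sup>2"
      \<comment> \<open>The quadratic remainder divided by \<open>t n\<close> leaves a multiple of
        \<open>t n\<close> that does not depend on \<open>x\<close>, so the convergence is uniform
        on \<open>U\<close>.\<close>
      have bound: "norm (q n x - fderiv f x h) \<le> C * t n" if x: "x \<in> U" for n x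
      proof -
        have b: "norm (f (x + t n *\<^sub>R h) - f x - fderiv f x (t n *\<^sub>R h))
            \<le> 8 * M / (r/2)\<^sup>2 * (norm (t n *\<^sub>R h))\<^sup>2"
          using sub[OF x] th[of n] rM by (intro frechet_holomorphic_bounds(2)[OF fr[OF x]]) auto
        moreover have "q n x - fderiv f x h =
            (1 / t n) *\<^sub>R (f (x + t n *\<^sub>R h) - f x - fderiv f x (t n *\<^sub>R h))"
          using t0[of n] by (simp add: q_def blinfun.scaleR_right algebra_simps)
        ultimately have "norm (q n x - fderiv f x h) \<le> (1 / t n) * (8 * M / (r/2)\<^sup>2 * (norm (t n *\<^sub>R h))\<^sup>2)"
          using mult_left_mono[OF b, of "1 / t n"] t0[of n] by (simp only: norm_scaleR) simp
        also have "\<dots> = C * t n"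
          using t0[of n] by (simp add: C_def power_mult_distrib power2_eq_square)
        finally show ?thesis .
      qed
      have "(\<lambda>n. C * (1 / real (n + N))) \<longlonglongrightarrow> C * 0"
        by (intro tendsto_mult tendsto_const LIMSEQ_ignore_initial_segment lim_1_over_n)
      then have "\<forall>\<^sub>F n in sequentially. C * t n < e"
        unfolding t_def using e by (intro order_tendstoD) simp_all
      then show "\<forall>\<^sub>F n in sequentially. \<forall>x\<in>U. dist (q n x) (fderiv f x h) < e"
      proof eventually_elim
        case (elim n)
        then show ?case unfolding dist_norm using bound by (blast intro: le_less_trans)
      qed
    qed
  qed
  moreover have "a \<in> U" using rM by (simp add: U_def)
  ultimately show "\<exists>D. bounded_clinear D \<and> ((\<lambda>x. fderiv f x h) has_derivative D) (at a)"
    by (auto simp: frechet_holomorphic_on_def)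
qed

text \<open>Each directional derivative is holomorphic, and its Cauchy bound
  \<open>K * norm h\<close> is linear in \<open>norm h\<close>. Its quadratic remainder is therefore
  small in operator norm, which upgrades differentiability in each direction to that of
  \<open>fderiv f\<close>.\<close>

theorem frechet_holomorphic_on_fderiv:
  fixes f :: "'a::complex_normed_vector \<Rightarrow> 'b::complex_banach"
  assumes f: "frechet_holomorphic_on f S"
  shows "frechet_holomorphic_on (fderiv f) S"
  unfolding frechet_holomorphic_on_def
proof (intro conjI ballI)
  show "open S" using f by (simp add: frechet_holomorphic_on_def)
  fix a assume a: "a \<in> S"
  obtain r M where rM: "0 < r" "0 \<le> M" "ball a r \<subseteq> S" "\<And>x. x \<in> ball a r \<Longrightarrow> norm (f x) \<le> M"
    using frechet_holomorphic_locally_bounded[OF f a] by metis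
  let ?p = "\<lambda>h x. fderiv f x h"
  define K where "K = 2 * M / (r/2)"
  have "0 \<le> K" using rM by (simp add: K_def)
  have bd: "norm (?p h x) \<le> K * norm h" if x: "x \<in> ball a (r/2)" for x h
  proof -
    have sub: "ball x (r/2) \<subseteq> ball a r"
    proof
      fix y assume "y \<in> ball x (r/2)"
      then show "y \<in> ball a r" using x dist_triangle[of a y x] by simp
    qed
    then show ?thesis unfolding K_def using rM
      by (intro frechet_holomorphic_bounds(1) frechet_holomorphic_on_subset[OF f]) auto
  qed
  have holp: "frechet_holomorphic_on (?p h) S" for h
    by (rule frechet_holomorphic_on_directional_derivative[OF f])
  have pr: "frechet_holomorphic_on (?p h) (ball a (r/2))" for h
    using rM by (intro frechet_holomorphic_on_subset[OF holp]) auto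
  define E where "E = (\<lambda>h. fderiv (?p h) a)"
  have E: "(?p h has_derivative blinfun_apply (E h)) (at a)" "E h (c *\<^sub>C k) = c *\<^sub>C E h k" for h c k
    unfolding E_def using frechet_holomorphic_onD[OF holp a] by auto
  have Ebd: "norm (E h k) \<le> 2 * (K * norm h) / (r/2) * norm k" for h k
    unfolding E_def using rM bd by (intro frechet_holomorphic_bounds(1)[OF pr]) auto
  have Eadd: "E (h + h') = E h + E h'" for h h'
    unfolding E_def using has_derivative_add[OF E(1)[of h] E(1)[of h']]
    by (intro fderiv_eqI) (simp add: blinfun.add_right plus_blinfun.rep_eq E_def)
  have Escale: "E (s *\<^sub>R h) = s *\<^sub>R E h" for s h
    unfolding E_def using has_derivative_scaleR_right[OF E(1)[of h], of s]
    by (intro fderiv_eqI) (simp add: blinfun.scaleR_right scaleR_blinfun.rep_eq E_def)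
  define C where "C = 2 * K / (r/2)"
  have "0 \<le> C" using \<open>0 \<le> K\<close> rM by (simp add: C_def)
  \<comment> \<open>\<open>L\<close> swaps the arguments of \<open>E\<close>: as the derivative of
    \<open>fderiv f\<close> it must take the increment \<open>k\<close> of the base point
    first.\<close>
  define L where "L = (\<lambda>k. Blinfun (\<lambda>h. E h k))"
  have Lbl: "bounded_linear (\<lambda>h. E h k)" for k
    by (rule bounded_linear_intro[of _ "C * norm k"])
      (use Ebd[of _ k] in \<open>simp_all add: Eadd Escale blinfun.add_left blinfun.scaleR_left C_def ac_simps\<close>)
  have L: "L k h = E h k" for k h
    unfolding L_def by (simp add: bounded_linear_Blinfun_apply[OF Lbl])
  have "bounded_linear L"
  proof (rule bounded_linear_intro[of _ C])
    show "norm (L k) \<le> norm k * C" for k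
      using Ebd[of _ k] rM \<open>0 \<le> C\<close> by (intro norm_blinfun_bound mult_nonneg_nonneg) (simp_all add: L C_def ac_simps)
  qed (auto intro!: blinfun_eqI simp: L blinfun.add_right blinfun.scaleR_right blinfun.add_left blinfun.scaleR_left)
  moreover have "L (c *\<^sub>C k) = c *\<^sub>C L k" for c k
    by (intro blinfun_eqI) (simp add: L E(2) scaleC_blinfun.rep_eq)
  ultimately have "bounded_clinear L" by (simp add: bounded_clinear_def)
  moreover have "(fderiv f has_derivative L) (at a)"
  proof (rule has_derivative_if_quadratic_remainder)
    fix k :: 'a assume k: "norm k < r/4"
    show "norm (fderiv f (a + k) - fderiv f a - L k) \<le> 8 * K / (r/2)\<^sup>2 * (norm k)\<^sup>2"
    proof (rule norm_blinfun_bound)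
      fix h
      have "norm (?p h (a + k) - ?p h a - E h k) \<le> 8 * (K * norm h) / (r/2)\<^sup>2 * (norm k)\<^sup>2"
        unfolding E_def using rM bd k by (intro frechet_holomorphic_bounds(2)[OF pr]) auto
      then show "norm ((fderiv f (a + k) - fderiv f a - L k) h) \<le> 8 * K / (r/2)\<^sup>2 * (norm k)\<^sup>2 * norm h"
        by (simp add: blinfun.diff_left L ac_simps)
    qed (use \<open>0 \<le> K\<close> in simp)
  qed (use rM \<open>bounded_linear L\<close> in auto)
  ultimately show "\<exists>D. bounded_clinear D \<and> (fderiv f has_derivative D) (at a)" by blast
qed

subsection \<open>Coefficients along a complex line\<close>

text \<open>Evaluation at \<open>h\<close> is bounded linear and commutes with differentiation, so
  curried higher derivatives applied to a fixed vector become iterated directional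
  derivatives.\<close>

lemma frechet_holomorphic_on_blinfun_apply:
  fixes G :: "'a::complex_normed_vector \<Rightarrow> 'c::real_normed_vector \<Rightarrow>\<^sub>L 'b::complex_normed_vector"
  assumes G: "frechet_holomorphic_on G S"
  shows "frechet_holomorphic_on (\<lambda>x. G x h) S"
    "x \<in> S \<Longrightarrow> fderiv (\<lambda>x. G x h) x k = fderiv G x k h"
proof -
  have 1: "((\<lambda>x. G x h) has_derivative (\<lambda>k. fderiv G x k h)) (at x)" if "x \<in> S" for x
    by (rule bounded_linear.has_derivative[OF blinfun.bounded_linear_left frechet_holomorphic_onD(1)[OF G that]])
  moreover have "bounded_clinear (\<lambda>k. fderiv G x k h)" if "x \<in> S" for x
    unfolding bounded_clinear_def
    using has_derivative_bounded_linear[OF 1[OF that]] frechet_holomorphic_onD(2)[OF G that]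
    by (simp add: scaleC_blinfun.rep_eq)
  ultimately show hol: "frechet_holomorphic_on (\<lambda>x. G x h) S"
    using G by (auto simp: frechet_holomorphic_on_def)
  show "fderiv (\<lambda>x. G x h) x k = fderiv G x k h" if "x \<in> S"
    using has_derivative_unique[OF frechet_holomorphic_onD(1)[OF hol that] 1[OF that]] by metis
qed

lemma has_derivative_scaleC_self:
  assumes g: "frechet_holomorphic_on g S" and F: "\<And>x. x \<in> S \<Longrightarrow> F x = g x *\<^sub>C x" and x: "x \<in> S"
  shows "(F has_derivative (\<lambda>h. g x *\<^sub>C h + fderiv g x h *\<^sub>C x)) (at x)"
proof (rule has_derivative_transform_within_open[of _ _ _ UNIV S])
  show "((\<lambda>x. g x *\<^sub>C x) has_derivative (\<lambda>h. g x *\<^sub>C h + fderiv g x h *\<^sub>C x)) (at x)"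
    by (rule bounded_bilinear.FDERIV[OF bounded_bilinear_scaleC frechet_holomorphic_onD(1)[OF g x] has_derivative_ident])
qed (use assms in \<open>auto simp: frechet_holomorphic_on_def\<close>)

lemma has_field_derivative_along_radius:
  assumes f: "frechet_holomorphic_on f (ball 0 1)" and T: "bounded_clinear (blinfun_apply T)"
    and "norm x\<^sub>0 = 1" "cmod \<zeta> < 1"
  shows "((\<lambda>\<zeta>. blinfun_apply T (f (\<zeta> *\<^sub>C x\<^sub>0))) has_field_derivative
    blinfun_apply T (fderiv f (\<zeta> *\<^sub>C x\<^sub>0) x\<^sub>0)) (at \<zeta>)"
  using has_field_derivative_along_line[OF f T, of 0 \<zeta> x\<^sub>0] assms(3,4) by (simp add: norm_scaleC)

lemma has_field_derivative_along_radius_complex: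
  assumes "frechet_holomorphic_on g (ball 0 1)" and "norm x\<^sub>0 = 1" "cmod \<zeta> < 1"
  shows "((\<lambda>\<zeta>. g (\<zeta> *\<^sub>C x\<^sub>0)) has_field_derivative fderiv g (\<zeta> *\<^sub>C x\<^sub>0) x\<^sub>0) (at \<zeta>)"
  using has_field_derivative_along_radius[of g id_blinfun x\<^sub>0 \<zeta>] assms
  by (simp add: bounded_clinear_def)

lemma has_field_derivative_unique_open:
  assumes "(u has_field_derivative a) (at z)" "(v has_field_derivative b) (at z)"
    and "open S" "z \<in> S" "\<And>z. z \<in> S \<Longrightarrow> u z = v z"
  shows "a = b"
  using has_field_derivative_transform_within_open[OF assms(1,3,4,5)] assms(2) by (rule DERIV_unique)

text \<open>Since \<open>T x\<^sub>0 = 1\<close>, the function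
  \<open>T (F (\<zeta> *\<^sub>C x\<^sub>0))\<close> equals \<open>\<zeta> * \<phi> \<zeta>\<close>.
  Its second and third derivatives at 0 are \<open>2 * deriv \<phi> 0\<close> and
  \<open>3 * deriv (deriv \<phi>) 0\<close>; division by \<open>fact 2\<close> and
  \<open>fact 3\<close> gives the coefficients.\<close>

lemma hankel_2_1_scaleC_self:
  fixes F :: "'a::complex_banach \<Rightarrow> 'a"
  assumes holF: "frechet_holomorphic_on F (ball 0 1)" and g: "frechet_holomorphic_on g (ball 0 1)"
    and F: "\<And>x. x \<in> ball 0 1 \<Longrightarrow> F x = g x *\<^sub>C x"
    and x\<^sub>0: "norm x\<^sub>0 = 1" and T: "T \<in> support_functionals x\<^sub>0"
  defines "\<phi> \<equiv> \<lambda>\<zeta>. g (\<zeta> *\<^sub>C x\<^sub>0)"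
  shows "hankel_2_1 F x\<^sub>0 T = deriv (deriv \<phi>) 0 / 2 - (deriv \<phi> 0)\<^sup>2"
proof -
  let ?B = "ball (0::complex) 1"
  have Tc: "bounded_clinear (blinfun_apply T)" and Tx: "T x\<^sub>0 = 1"
    using T x\<^sub>0 by (auto simp: support_functionals_def)
  let ?F1 = "\<lambda>x. fderiv F x x\<^sub>0" and ?F2 = "\<lambda>x. fderiv (fderiv F) x x\<^sub>0 x\<^sub>0"
  have holF1: "frechet_holomorphic_on ?F1 (ball 0 1)"
    by (intro frechet_holomorphic_on_blinfun_apply(1) frechet_holomorphic_on_fderiv holF)
  have holF2: "frechet_holomorphic_on ?F2 (ball 0 1)"
    by (intro frechet_holomorphic_on_blinfun_apply(1) frechet_holomorphic_on_fderiv holF)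
  have F2: "fderiv ?F1 x x\<^sub>0 = ?F2 x" if "x \<in> ball 0 1" for x
    using frechet_holomorphic_on_blinfun_apply(2)[OF frechet_holomorphic_on_fderiv[OF holF] that] .
  have F3: "fderiv ?F2 x x\<^sub>0 = fderiv (fderiv (fderiv F)) x x\<^sub>0 x\<^sub>0 x\<^sub>0" if "x \<in> ball 0 1" for x
    using frechet_holomorphic_on_blinfun_apply(2)[OF frechet_holomorphic_on_blinfun_apply(1)[OF
          frechet_holomorphic_on_fderiv[OF frechet_holomorphic_on_fderiv[OF holF]]] that]
      frechet_holomorphic_on_blinfun_apply(2)[OF
          frechet_holomorphic_on_fderiv[OF frechet_holomorphic_on_fderiv[OF holF]] that]
    by metis
  have mem: "\<zeta> *\<^sub>C x\<^sub>0 \<in> ball 0 1" if "\<zeta> \<in> ?B" for \<zeta>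
    using that x\<^sub>0 by (simp add: norm_scaleC)
  let ?u = "\<lambda>\<zeta>. T (F (\<zeta> *\<^sub>C x\<^sub>0))" and ?u1 = "\<lambda>\<zeta>. T (?F1 (\<zeta> *\<^sub>C x\<^sub>0))" and ?u2 = "\<lambda>\<zeta>. T (?F2 (\<zeta> *\<^sub>C x\<^sub>0))"
  have d1: "(?u has_field_derivative ?u1 \<zeta>) (at \<zeta>)" if "\<zeta> \<in> ?B" for \<zeta>
    using has_field_derivative_along_radius[OF holF Tc x\<^sub>0] that by simp
  have d2: "(?u1 has_field_derivative ?u2 \<zeta>) (at \<zeta>)" if "\<zeta> \<in> ?B" for \<zeta>
    using has_field_derivative_along_radius[OF holF1 Tc x\<^sub>0, of \<zeta>] that F2[OF mem[OF that]] by simp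
  have d3: "(?u2 has_field_derivative T (fderiv (fderiv (fderiv F)) 0 x\<^sub>0 x\<^sub>0 x\<^sub>0)) (at 0)"
    using has_field_derivative_along_radius[OF holF2 Tc x\<^sub>0, of 0] F3[of 0] by simp
  have hol\<phi>: "\<phi> holomorphic_on ?B"
    unfolding holomorphic_on_open[OF open_ball] \<phi>_def
    by (intro ballI exI, rule has_field_derivative_along_radius_complex[OF g x\<^sub>0]) simp
  note \<phi>' = holomorphic_derivI[OF hol\<phi> open_ball]
  note \<phi>'' = holomorphic_derivI[OF holomorphic_deriv[OF hol\<phi> open_ball] open_ball]
  note \<phi>''' = holomorphic_derivI[OF holomorphic_deriv[OF holomorphic_deriv[OF hol\<phi> open_ball] open_ball] open_ball]
  have u: "?u \<zeta> = \<zeta> * \<phi> \<zeta>" if "\<zeta> \<in> ?B" for \<zeta>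
    using F[OF mem[OF that]] by (simp add: bounded_clinearD(2)[OF Tc] Tx scaleC_complex_def \<phi>_def)
  have u1: "?u1 \<zeta> = \<phi> \<zeta> + \<zeta> * deriv \<phi> \<zeta>" if "\<zeta> \<in> ?B" for \<zeta>
  proof (rule has_field_derivative_unique_open[OF d1[OF that] _ open_ball that u])
    show "((\<lambda>\<zeta>. \<zeta> * \<phi> \<zeta>) has_field_derivative \<phi> \<zeta> + \<zeta> * deriv \<phi> \<zeta>) (at \<zeta>)"
      by (rule derivative_eq_intros \<phi>'[OF that] refl)+ simp
  qed
  have u2: "?u2 \<zeta> = 2 * deriv \<phi> \<zeta> + \<zeta> * deriv (deriv \<phi>) \<zeta>" if "\<zeta> \<in> ?B" for \<zeta>
  proof (rule has_field_derivative_unique_open[OF d2[OF that] _ open_ball that u1])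
    show "((\<lambda>\<zeta>. \<phi> \<zeta> + \<zeta> * deriv \<phi> \<zeta>) has_field_derivative 2 * deriv \<phi> \<zeta> + \<zeta> * deriv (deriv \<phi>) \<zeta>) (at \<zeta>)"
      by (rule derivative_eq_intros \<phi>'[OF that] \<phi>''[OF that] refl)+ simp
  qed
  have z: "0 \<in> ?B" by simp
  have u3: "T (fderiv (fderiv (fderiv F)) 0 x\<^sub>0 x\<^sub>0 x\<^sub>0) = 3 * deriv (deriv \<phi>) 0"
  proof (rule has_field_derivative_unique_open[OF d3 _ open_ball z u2])
    show "((\<lambda>\<zeta>. 2 * deriv \<phi> \<zeta> + \<zeta> * deriv (deriv \<phi>) \<zeta>) has_field_derivative 3 * deriv (deriv \<phi>) 0) (at 0)"
      by (rule derivative_eq_intros \<phi>''[OF z] \<phi>'''[OF z] refl)+ simp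
  qed
  show ?thesis
    using u2[OF z] u3 by (simp add: hankel_2_1_def coeff2_def coeff3_def fact_numeral)
qed

subsection \<open>Starlike mappings of the form \<open>g(x)x\<close>\<close>

text \<open>The vector \<open>x\<close> is an eigenvector of \<open>fderiv F x\<close> with
  eigenvalue \<open>g x + fderiv g x x\<close>. Invertibility makes this nonzero, and the preimage
  of \<open>F x\<close> is again a multiple of \<open>x\<close>.\<close>

lemma starlike_field_scaleC_self:
  fixes F :: "'a::complex_normed_vector \<Rightarrow> 'a"
  assumes F: "locally_biholomorphic F" and g: "frechet_holomorphic_on g (ball 0 1)"
    and Fg: "\<And>x. x \<in> ball 0 1 \<Longrightarrow> F x = g x *\<^sub>C x" and x: "x \<in> ball 0 1" "x \<noteq> 0"
  shows "g x + fderiv g x x \<noteq> 0" "starlike_field F x = (g x / (g x + fderiv g x x)) *\<^sub>C x"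
proof -
  obtain G where G: "G o\<^sub>L fderiv F x = id_blinfun"
    using F x(1) unfolding locally_biholomorphic_def by blast
  have GF: "G (fderiv F x h) = h" for h
    using arg_cong[OF G, of "\<lambda>B. blinfun_apply B h"] by simp
  then have inj: "inj (blinfun_apply (fderiv F x))" by (rule inj_on_inverseI)
  have hol: "frechet_holomorphic_on F (ball 0 1)" using F by (simp add: locally_biholomorphic_def)
  let ?d = "g x + fderiv g x x"
  have "blinfun_apply (fderiv F x) = (\<lambda>h. g x *\<^sub>C h + fderiv g x h *\<^sub>C x)"
    using frechet_holomorphic_onD(1)[OF hol x(1)] has_derivative_scaleC_self[OF g Fg x(1)]
    by (rule has_derivative_unique)
  then have Fx: "fderiv F x x = ?d *\<^sub>C x" by (simp add: scaleC_add_left)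
  show d: "?d \<noteq> 0"
  proof
    assume "?d = 0"
    then have "fderiv F x x = 0" using Fx by simp
    then show False using GF[of x] x(2) by (simp add: blinfun.zero_right)
  qed
  have "fderiv F x ((g x / ?d) *\<^sub>C x) = F x"
    using d by (simp add: frechet_holomorphic_onD(2)[OF hol x(1)] Fx scaleC_scaleC Fg[OF x(1)])
  then show "starlike_field F x = (g x / ?d) *\<^sub>C x"
    unfolding starlike_field_def using inj by (metis inv_f_f)
qed

text \<open>Squaring \<open>cmod (q - b) < b\<close> with \<open>b = 1 / (2 * \<alpha>)\<close>
  cancels \<open>b\<^sup>2\<close>. The result also reads correctly for \<open>\<alpha> = 0\<close>,
  so a single inequality replaces the case distinction of the class.\<close>

lemma starlike_order_condition_iff:
  assumes "0 \<le> \<alpha>" "0 < r"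
  shows "(if \<alpha> = 0 then Re (q * complex_of_real r) > 0
      else cmod (complex_of_real (1 / r) * (q * complex_of_real r) - complex_of_real (1 / (2 * \<alpha>))) < 1 / (2 * \<alpha>))
    \<longleftrightarrow> \<alpha> * (cmod q)\<^sup>2 < Re q"
proof (cases "\<alpha> = 0")
  case False
  with assms have \<alpha>: "0 < \<alpha>" by simp
  let ?b = "1 / (2 * \<alpha>)"
  have q: "complex_of_real (1 / r) * (q * complex_of_real r) = q" using assms by simp
  have "cmod (q - complex_of_real ?b) < ?b \<longleftrightarrow> (cmod (q - complex_of_real ?b))\<^sup>2 < ?b\<^sup>2"
    using \<alpha> by (simp add: power_mono_iff del: of_real_divide flip: not_le)
  also have "(cmod (q - complex_of_real ?b))\<^sup>2 = (cmod q)\<^sup>2 - Re q / \<alpha> + ?b\<^sup>2"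
    unfolding cmod_power2 using \<alpha> by (simp add: power2_eq_square algebra_simps)
  also have "\<dots> < ?b\<^sup>2 \<longleftrightarrow> \<alpha> * (cmod q)\<^sup>2 < Re q"
    using \<alpha> by (simp add: pos_less_divide_eq mult.commute)
  finally show ?thesis using False unfolding q by simp
qed (use assms in \<open>simp add: zero_less_mult_iff\<close>)

text \<open>The starlike field is a multiple of \<open>x\<close> and \<open>T x = norm x\<close>, so
  the choice of \<open>T\<close> drops out. From left to right, the existence of a support
  functional keeps the quantification over \<open>T\<close> from being empty.\<close>

lemma starlike_mappings_scaleC_self_iff:
  fixes F :: "'a::complex_normed_vector \<Rightarrow> 'a"
  assumes "0 \<le> \<alpha>" and g: "frechet_holomorphic_on g (ball 0 1)"
    and F: "\<And>x. x \<in> ball 0 1 \<Longrightarrow> F x = g x *\<^sub>C x"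
  shows "F \<in> starlike_mappings \<alpha> \<longleftrightarrow> normalized F \<and> locally_biholomorphic F \<and>
    (\<forall>x\<in>ball 0 1 - {0}. \<alpha> * (cmod (g x / (g x + fderiv g x x)))\<^sup>2 < Re (g x / (g x + fderiv g x x)))"
proof -
  have "(if \<alpha> = 0 then Re (blinfun_apply T (starlike_field F x)) > 0
           else cmod (complex_of_real (1 / norm x) * blinfun_apply T (starlike_field F x)
                      - complex_of_real (1 / (2 * \<alpha>))) < 1 / (2 * \<alpha>)) \<longleftrightarrow>
      \<alpha> * (cmod (g x / (g x + fderiv g x x)))\<^sup>2 < Re (g x / (g x + fderiv g x x))"
    if "locally_biholomorphic F" "x \<in> ball 0 1 - {0}" "T \<in> support_functionals x" for x T
  proof -
    have "T (starlike_field F x) = g x / (g x + fderiv g x x) * complex_of_real (norm x)"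
      using starlike_field_scaleC_self(2)[OF that(1) g F] that(2,3)
      by (simp add: support_functionals_def bounded_clinearD(2) scaleC_complex_def)
    then show ?thesis
      using starlike_order_condition_iff[OF assms(1), of "norm x"] that(2) by (simp only:) simp
  qed
  moreover have "\<exists>T. T \<in> support_functionals x" if "x \<in> ball 0 1 - {0}" for x :: 'a
    using support_functional_exists[of x] that by auto
  ultimately show ?thesis unfolding starlike_mappings_def by blast
qed

subsection \<open>The one-variable inequality\<close>

text \<open>A Moebius map moving \<open>f 0\<close> to the origin reduces the strict case to the
  Schwarz lemma. The weak bound, which admits unimodular constants, follows by scaling with
  \<open>s < 1\<close> and letting \<open>s\<close> tend to 1.\<close>

lemma Schwarz_Pick_at_0:
  assumes hol: "\<psi> holomorphic_on ball 0 1" and le: "\<And>z. cmod z < 1 \<Longrightarrow> cmod (\<psi> z) \<le> 1"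
  shows "cmod (deriv \<psi> 0) \<le> 1 - (cmod (\<psi> 0))\<^sup>2"
proof -
  have strict: "cmod (deriv f 0) \<le> 1 - (cmod (f 0))\<^sup>2"
    if f: "f holomorphic_on ball 0 1" and lt: "\<And>z. cmod z < 1 \<Longrightarrow> cmod (f z) < 1" for f
  proof -
    let ?c = "f 0"
    define h where "h = Moebius_function 0 ?c \<circ> f"
    have c: "cmod ?c < 1" using lt by simp
    have "h holomorphic_on ball 0 1"
      unfolding h_def using lt
      by (intro holomorphic_on_compose_gen[OF f Moebius_function_holomorphic[OF c]]) auto
    moreover have "cmod (h z) < 1" if "cmod z < 1" for z
      unfolding h_def using Moebius_function_norm_lt_1[OF c lt[OF that]] by simp
    moreover have "h 0 = 0" by (simp add: h_def Moebius_function_eq_zero)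
    ultimately have h1: "cmod (deriv h 0) \<le> 1"
      by (intro Schwarz_Lemma(2)[of h 0]) auto
    have pos: "0 < 1 - (cmod ?c)\<^sup>2" using c by (simp add: abs_square_less_1)
    have cc: "1 - cnj ?c * ?c = complex_of_real (1 - (cmod ?c)\<^sup>2)"
      by (simp add: complex_norm_square[symmetric] mult.commute)
    then have ne: "1 - cnj ?c * ?c \<noteq> 0" using pos by (metis of_real_eq_0_iff less_irrefl)
    then have ne': "cnj ?c * ?c \<noteq> 1" by auto
    have "(h has_field_derivative deriv f 0 / (1 - cnj ?c * ?c)) (at 0)"
      unfolding h_def o_def Moebius_function_simple
      by (rule derivative_eq_intros holomorphic_derivI[OF f open_ball] refl | simp add: ne ne')+
    then have "deriv h 0 = deriv f 0 / complex_of_real (1 - (cmod ?c)\<^sup>2)"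
      unfolding cc by (rule DERIV_imp_deriv)
    then have "cmod (deriv h 0) = cmod (deriv f 0) / (1 - (cmod ?c)\<^sup>2)"
      using pos by (simp only: norm_divide norm_of_real abs_of_pos)
    then show ?thesis using h1 pos by (simp add: pos_divide_le_eq)
  qed
  have scaled: "s * cmod (deriv \<psi> 0) \<le> 1 - s\<^sup>2 * (cmod (\<psi> 0))\<^sup>2" if s: "0 < s" "s < 1" for s
  proof -
    let ?f = "\<lambda>z. complex_of_real s * \<psi> z"
    have "cmod (deriv ?f 0) \<le> 1 - (cmod (?f 0))\<^sup>2"
    proof (rule strict)
      show "?f holomorphic_on ball 0 1" by (intro holomorphic_intros hol)
      show "cmod (?f z) < 1" if "cmod z < 1" for z
      proof -
        have "cmod (?f z) = s * cmod (\<psi> z)" using s by (simp add: norm_mult)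
        also have "\<dots> \<le> s * 1" using s by (intro mult_left_mono le that) simp
        finally show ?thesis using s by simp
      qed
    qed
    moreover have "deriv ?f 0 = complex_of_real s * deriv \<psi> 0"
      by (intro DERIV_imp_deriv DERIV_cmult holomorphic_derivI[OF hol open_ball]) simp
    ultimately show ?thesis using s by (simp add: norm_mult power_mult_distrib)
  qed
  have "1 * cmod (deriv \<psi> 0) \<le> 1 - 1\<^sup>2 * (cmod (\<psi> 0))\<^sup>2"
  proof (rule tendsto_le)
    show "((\<lambda>s. s * cmod (deriv \<psi> 0)) \<longlongrightarrow> 1 * cmod (deriv \<psi> 0)) (at_left 1)"
      by (intro tendsto_intros)
    show "((\<lambda>s. 1 - s\<^sup>2 * (cmod (\<psi> 0))\<^sup>2) \<longlongrightarrow> 1 - 1\<^sup>2 * (cmod (\<psi> 0))\<^sup>2) (at_left 1)"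
      by (intro tendsto_intros)
    show "\<forall>\<^sub>F s in at_left 1. s * cmod (deriv \<psi> 0) \<le> 1 - s\<^sup>2 * (cmod (\<psi> 0))\<^sup>2"
      using eventually_at_left_real[of 0 1] by (rule eventually_mono) (auto intro: scaled)
  qed simp
  then show ?thesis by simp
qed

text \<open>
  The Cayley-type transform \<open>(1 - q) / (1 + (1 - 2\<alpha>) q)\<close> maps the range of \<open>q\<close>, a disc or a
  half-plane, into the unit disc.
\<close>

lemma cmod_one_minus_less:
  assumes "\<alpha> < 1" "\<alpha> * (cmod q)\<^sup>2 < Re q"
  shows "cmod (1 - q) < cmod (1 + complex_of_real (1 - 2 * \<alpha>) * q)"
proof -
  have "(cmod (1 + complex_of_real (1 - 2 * \<alpha>) * q))\<^sup>2 - (cmod (1 - q))\<^sup>2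
      = 4 * (1 - \<alpha>) * (Re q - \<alpha> * (cmod q)\<^sup>2)"
    unfolding cmod_power2 by (simp add: power2_eq_square algebra_simps)
  also have "\<dots> > 0" using assms by simp
  finally show ?thesis by (simp add: power2_less_imp_less)
qed

text \<open>
  With \<open>p = 1 + \<zeta>\<phi>'/\<phi>\<close> the function \<open>\<omega> = (p - 1) / (p + 1 - 2\<alpha>)\<close> is a Schwarz function; with
  \<open>\<psi> = \<omega>/\<zeta>\<close> one has \<open>\<phi>''(0)/2 - \<phi>'(0)\<^sup>2 = (1 - \<alpha>) (\<psi>'(0) + (2\<alpha> - 1) \<psi>(0)\<^sup>2)\<close>.
\<close>

lemma starlike_second_coefficient_bound:
  assumes hol: "\<phi> holomorphic_on ball 0 1" and \<phi>0: "\<phi> 0 = 1" and \<alpha>: "0 \<le> \<alpha>" "\<alpha> < 1"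
    and ne: "\<And>\<zeta>. \<zeta> \<noteq> 0 \<Longrightarrow> cmod \<zeta> < 1 \<Longrightarrow> \<phi> \<zeta> + \<zeta> * deriv \<phi> \<zeta> \<noteq> 0"
    and cond: "\<And>\<zeta>. \<zeta> \<noteq> 0 \<Longrightarrow> cmod \<zeta> < 1 \<Longrightarrow>
      \<alpha> * (cmod (\<phi> \<zeta> / (\<phi> \<zeta> + \<zeta> * deriv \<phi> \<zeta>)))\<^sup>2 < Re (\<phi> \<zeta> / (\<phi> \<zeta> + \<zeta> * deriv \<phi> \<zeta>))"
  shows "cmod (deriv (deriv \<phi>) 0 / 2 - (deriv \<phi> 0)\<^sup>2) \<le> 1 - \<alpha>"
proof -
  let ?B = "ball (0::complex) 1"
  define \<beta> where "\<beta> = complex_of_real (1 - \<alpha>)"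
  \<comment> \<open>With \<open>p\<close> as above this is \<open>\<phi>\<close> times
    \<open>p + 1 - 2\<alpha>\<close>, so the Schwarz function is the quotient of
    \<open>\<zeta> * deriv \<phi> \<zeta>\<close> and \<open>d \<zeta>\<close>.\<close>
  define d where "d = (\<lambda>\<zeta>. 2 * \<beta> * \<phi> \<zeta> + \<zeta> * deriv \<phi> \<zeta>)"
  have hol': "deriv \<phi> holomorphic_on ?B" by (rule holomorphic_deriv[OF hol open_ball])
  have hold: "d holomorphic_on ?B"
    unfolding d_def by (intro holomorphic_intros hol hol')
  have \<beta>: "\<beta> \<noteq> 0" using \<alpha> by (simp add: \<beta>_def flip: of_real_diff)
  have less: "cmod (\<zeta> * deriv \<phi> \<zeta>) < cmod (d \<zeta>)" if "cmod \<zeta> < 1" for \<zeta>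
  proof (cases "\<zeta> = 0")
    case True
    then show ?thesis using \<beta> \<phi>0 by (simp add: d_def)
  next
    case False
    define e where "e = \<phi> \<zeta> + \<zeta> * deriv \<phi> \<zeta>"
    have e: "e \<noteq> 0" unfolding e_def using ne False that by blast
    \<comment> \<open>The Cayley-type inequality for \<open>q = \<phi> \<zeta> / e\<close> is
      multiplied by \<open>e\<close> to clear denominators; its sides become numerator and
      denominator of the Schwarz function.\<close>
    have "cmod (1 - \<phi> \<zeta> / e) < cmod (1 + complex_of_real (1 - 2 * \<alpha>) * (\<phi> \<zeta> / e))"
      unfolding e_def by (intro cmod_one_minus_less \<alpha> cond False that)
    then have "cmod (e * (1 - \<phi> \<zeta> / e)) < cmod (e * (1 + complex_of_real (1 - 2 * \<alpha>) * (\<phi> \<zeta> / e)))"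
      using e by (simp add: norm_mult)
    moreover have "e * (1 - \<phi> \<zeta> / e) = \<zeta> * deriv \<phi> \<zeta>"
      using e by (simp add: right_diff_distrib) (simp add: e_def)
    moreover have "e * (1 + complex_of_real (1 - 2 * \<alpha>) * (\<phi> \<zeta> / e)) = d \<zeta>"
      using e by (simp add: distrib_left) (simp add: e_def d_def \<beta>_def algebra_simps)
    ultimately show ?thesis by simp
  qed
  have d0: "d \<zeta> \<noteq> 0" if "cmod \<zeta> < 1" for \<zeta>
    using less[OF that] by auto
  define \<psi> where "\<psi> = (\<lambda>\<zeta>. deriv \<phi> \<zeta> / d \<zeta>)"
  have hol\<psi>: "\<psi> holomorphic_on ?B"
    unfolding \<psi>_def using d0 by (intro holomorphic_intros hol' hold) auto
  define \<omega> where "\<omega> = (\<lambda>\<zeta>. \<zeta> * \<psi> \<zeta>)"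
  have hol\<omega>: "\<omega> holomorphic_on ?B"
    unfolding \<omega>_def by (intro holomorphic_intros hol\<psi>)
  have lt: "cmod (\<omega> \<zeta>) < 1" if "cmod \<zeta> < 1" for \<zeta>
    using less[OF that] d0[OF that] by (simp add: \<omega>_def \<psi>_def norm_divide norm_mult)
  have \<omega>0: "\<omega> 0 = 0" by (simp add: \<omega>_def)
  have "cmod (\<psi> \<zeta>) \<le> 1" if "cmod \<zeta> < 1" for \<zeta>
  proof (cases "\<zeta> = 0")
    case True
    \<comment> \<open>At the origin \<open>\<psi> 0\<close> is the derivative of
      \<open>\<omega>\<close>, so the derivative part of the Schwarz lemma applies there.\<close>
    have "(\<omega> has_field_derivative \<psi> 0) (at 0)"
      unfolding \<omega>_def by (rule derivative_eq_intros holomorphic_derivI[OF hol\<psi> open_ball] refl | simp)+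
    then have "deriv \<omega> 0 = \<psi> 0" by (rule DERIV_imp_deriv)
    then show ?thesis using Schwarz_Lemma(2)[OF hol\<omega> \<omega>0 lt, of 0] True by simp
  next
    case False
    then show ?thesis
      using Schwarz_Lemma(1)[OF hol\<omega> \<omega>0 lt that] by (simp add: \<omega>_def norm_mult)
  qed
  then have pick: "cmod (deriv \<psi> 0) \<le> 1 - (cmod (\<psi> 0))\<^sup>2"
    by (rule Schwarz_Pick_at_0[OF hol\<psi>])
  have z: "0 \<in> ?B" by simp
  have dd: "(d has_field_derivative (2 * \<beta> + 1) * deriv \<phi> 0) (at 0)"
    unfolding d_def
    by (rule derivative_eq_intros holomorphic_derivI[OF hol open_ball z] holomorphic_derivI[OF hol' open_ball z] refl)+
      (simp add: algebra_simps)
  \<comment> \<open>Differentiating \<open>\<psi> \<zeta> * d \<zeta> = deriv \<phi> \<zeta>\<close>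
    at 0, where \<open>d 0 = 2 * \<beta>\<close>, yields the second derivative of
    \<open>\<phi>\<close>.\<close>
  have "((\<lambda>\<zeta>. \<psi> \<zeta> * d \<zeta>) has_field_derivative deriv \<psi> 0 * d 0 + (2 * \<beta> + 1) * deriv \<phi> 0 * \<psi> 0) (at 0)"
    by (intro DERIV_mult holomorphic_derivI[OF hol\<psi> open_ball z] dd)
  then have "(deriv \<phi> has_field_derivative deriv \<psi> 0 * d 0 + (2 * \<beta> + 1) * deriv \<phi> 0 * \<psi> 0) (at 0)"
    by (rule has_field_derivative_transform_within_open[OF _ open_ball z]) (simp add: \<psi>_def d0)
  then have a2: "deriv (deriv \<phi>) 0 = deriv \<psi> 0 * (2 * \<beta>) + (2 * \<beta> + 1) * deriv \<phi> 0 * \<psi> 0"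
    using DERIV_imp_deriv by (simp add: d_def \<phi>0) blast
  have a1: "deriv \<phi> 0 = 2 * \<beta> * \<psi> 0"
    using \<beta> by (simp add: \<psi>_def d_def \<phi>0)
  have "deriv (deriv \<phi>) 0 / 2 - (deriv \<phi> 0)\<^sup>2 = \<beta> * (deriv \<psi> 0 + (1 - 2 * \<beta>) * (\<psi> 0)\<^sup>2)"
    unfolding a2 a1 by (simp add: power2_eq_square algebra_simps)
  also have "cmod \<dots> \<le> (1 - \<alpha>) * 1"
    unfolding norm_mult
  proof (rule mult_mono)
    show "cmod \<beta> \<le> 1 - \<alpha>" using \<alpha> unfolding \<beta>_def norm_of_real by simp
    \<comment> \<open>Here \<open>1 - 2 * \<beta> = 2 * \<alpha> - 1\<close> lies in
      \<open>[-1, 1)\<close>, so the quadratic term is absorbed by the Schwarz-Pick bound.\<close>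
    have "cmod (1 - 2 * \<beta>) \<le> 1"
    proof -
      have "1 - 2 * \<beta> = complex_of_real (2 * \<alpha> - 1)" by (simp add: \<beta>_def algebra_simps)
      then show ?thesis using \<alpha> by (simp only: norm_of_real)
    qed
    then have "cmod ((1 - 2 * \<beta>) * (\<psi> 0)\<^sup>2) \<le> (cmod (\<psi> 0))\<^sup>2"
      by (simp add: norm_mult norm_power mult_left_le_one_le)
    then show "cmod (deriv \<psi> 0 + (1 - 2 * \<beta>) * (\<psi> 0)\<^sup>2) \<le> 1"
      using pick norm_triangle_ineq[of "deriv \<psi> 0" "(1 - 2 * \<beta>) * (\<psi> 0)\<^sup>2"] by linarith
  qed (use \<alpha> in auto)
  finally show ?thesis by simp
qed

proposition hankel_2_1_starlike_bound:
  fixes F :: "'a::complex_banach \<Rightarrow> 'a"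
  assumes \<alpha>: "0 \<le> \<alpha>" "\<alpha> < 1" and g: "frechet_holomorphic_on g (ball 0 1)" "g 0 = 1"
    and F: "\<And>x. x \<in> ball 0 1 \<Longrightarrow> F x = g x *\<^sub>C x" "F \<in> starlike_mappings \<alpha>"
    and x\<^sub>0: "norm x\<^sub>0 = 1" and T: "T \<in> support_functionals x\<^sub>0"
  shows "cmod (hankel_2_1 F x\<^sub>0 T) \<le> 1 - \<alpha>"
proof -
  have lb: "locally_biholomorphic F"
    and q: "\<And>x. x \<in> ball 0 1 - {0} \<Longrightarrow>
      \<alpha> * (cmod (g x / (g x + fderiv g x x)))\<^sup>2 < Re (g x / (g x + fderiv g x x))"
    using F(2) starlike_mappings_scaleC_self_iff[OF \<alpha>(1) g(1) F(1)] by blast+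
  have holF: "frechet_holomorphic_on F (ball 0 1)" using lb by (simp add: locally_biholomorphic_def)
  define \<phi> where "\<phi> = (\<lambda>\<zeta>. g (\<zeta> *\<^sub>C x\<^sub>0))"
  have der: "(\<phi> has_field_derivative fderiv g (\<zeta> *\<^sub>C x\<^sub>0) x\<^sub>0) (at \<zeta>)" if "cmod \<zeta> < 1" for \<zeta>
    unfolding \<phi>_def by (rule has_field_derivative_along_radius_complex[OF g(1) x\<^sub>0 that])
  have mem: "\<zeta> *\<^sub>C x\<^sub>0 \<in> ball 0 1 - {0}" if "\<zeta> \<noteq> 0" "cmod \<zeta> < 1" for \<zeta>
    using that x\<^sub>0 norm_scaleC[of \<zeta> x\<^sub>0] by auto
  \<comment> \<open>By complex linearity the derivative of \<open>g\<close> at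
    \<open>\<zeta> *\<^sub>C x\<^sub>0\<close> in the radial direction is
    \<open>\<zeta> * deriv \<phi> \<zeta>\<close>, so the starlikeness condition becomes the
    one-variable one.\<close>
  have d: "\<phi> \<zeta> + \<zeta> * deriv \<phi> \<zeta> = g (\<zeta> *\<^sub>C x\<^sub>0) + fderiv g (\<zeta> *\<^sub>C x\<^sub>0) (\<zeta> *\<^sub>C x\<^sub>0)"
    if "\<zeta> \<noteq> 0" "cmod \<zeta> < 1" for \<zeta>
    using DERIV_imp_deriv[OF der[OF that(2)]] frechet_holomorphic_onD(2)[OF g(1)] mem[OF that]
    by (simp add: \<phi>_def scaleC_complex_def)
  have "cmod (deriv (deriv \<phi>) 0 / 2 - (deriv \<phi> 0)\<^sup>2) \<le> 1 - \<alpha>"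
  proof (rule starlike_second_coefficient_bound[OF _ _ \<alpha>])
    show "\<phi> holomorphic_on ball 0 1"
      unfolding holomorphic_on_open[OF open_ball] by (intro ballI exI, rule der) simp
    show "\<phi> 0 = 1" using g(2) by (simp add: \<phi>_def)
    fix \<zeta> :: complex assume \<zeta>: "\<zeta> \<noteq> 0" "cmod \<zeta> < 1"
    show "\<phi> \<zeta> + \<zeta> * deriv \<phi> \<zeta> \<noteq> 0"
      unfolding d[OF \<zeta>] using mem[OF \<zeta>] by (intro starlike_field_scaleC_self(1)[OF lb g(1) F(1)]) auto
    show "\<alpha> * (cmod (\<phi> \<zeta> / (\<phi> \<zeta> + \<zeta> * deriv \<phi> \<zeta>)))\<^sup>2 < Re (\<phi> \<zeta> / (\<phi> \<zeta> + \<zeta> * deriv \<phi> \<zeta>))"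
      using q[OF mem[OF \<zeta>]] unfolding d[OF \<zeta>] by (simp add: \<phi>_def)
  qed
  then show ?thesis
    unfolding \<phi>_def by (subst hankel_2_1_scaleC_self[OF holF g(1) F(1) x\<^sub>0 T])
qed

subsection \<open>The extremal mapping\<close>

text \<open>This is the principal branch of \<open>1 - z\<^sup>2\<close> raised to the power
  \<open>\<alpha> - 1\<close>; on the unit disc \<open>1 - z\<^sup>2\<close> has positive real part
  and avoids the cut of \<open>Ln\<close>. The exponential form makes the factor zero-free.\<close>

definition extremal_factor :: "real \<Rightarrow> complex \<Rightarrow> complex"
  where "extremal_factor \<alpha> z = exp (- complex_of_real (1 - \<alpha>) * Ln (1 - z\<^sup>2))"

definition extremal_log_derivative :: "real \<Rightarrow> complex \<Rightarrow> complex"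
  where "extremal_log_derivative \<alpha> z = 2 * complex_of_real (1 - \<alpha>) * z / (1 - z\<^sup>2)"

lemma one_minus_square_disc:
  assumes "cmod z < 1"
  shows "1 - z\<^sup>2 \<notin> \<real>\<^sub>\<le>\<^sub>0" "1 - z\<^sup>2 \<noteq> 0"
proof -
  have "cmod (z\<^sup>2) < 1" using assms by (simp add: norm_power power_less_one_iff abs_square_less_1)
  then have "0 < Re (1 - z\<^sup>2)" using complex_Re_le_cmod[of "z\<^sup>2"] by simp
  then show "1 - z\<^sup>2 \<notin> \<real>\<^sub>\<le>\<^sub>0" by (auto simp: complex_nonpos_Reals_iff)
  then show "1 - z\<^sup>2 \<noteq> 0" by auto
qed

lemma extremal_factor_has_field_derivative:
  assumes "cmod z < 1"
  shows "(extremal_factor \<alpha> has_field_derivative extremal_factor \<alpha> z * extremal_log_derivative \<alpha> z) (at z)"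
  unfolding extremal_factor_def[abs_def]
  by (rule derivative_eq_intros refl one_minus_square_disc[OF assms])+
    (simp add: extremal_log_derivative_def field_simps del: of_real_diff)

text \<open>With \<open>w = z\<^sup>2\<close> the expression is
  \<open>\<alpha> + (1 - \<alpha>) * ((1 + w) / (1 - w))\<close>, and
  \<open>(1 + w) / (1 - w)\<close> maps the disc into the right half-plane.\<close>

lemma extremal_log_derivative_Re:
  assumes "\<alpha> < 1" "cmod z < 1"
  shows "\<alpha> < Re (1 + extremal_log_derivative \<alpha> z * z)"
proof -
  define w where "w = z\<^sup>2"
  have w: "cmod w < 1" using assms(2) by (simp add: w_def norm_power power_less_one_iff abs_square_less_1)
  then have w1: "w \<noteq> 1" by auto
  have "1 + extremal_log_derivative \<alpha> z * z = complex_of_real \<alpha> + complex_of_real (1 - \<alpha>) * ((1 + w) / (1 - w))"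
    using w1 by (simp add: extremal_log_derivative_def w_def[symmetric] power2_eq_square[symmetric] field_simps)
      (simp add: w_def power2_eq_square algebra_simps)
  then have eq: "Re (1 + extremal_log_derivative \<alpha> z * z) = \<alpha> + (1 - \<alpha>) * Re ((1 + w) / (1 - w))"
    by (simp del: of_real_diff times_divide_eq_right)
  have "Re ((1 + w) / (1 - w)) = (1 - (cmod w)\<^sup>2) / (cmod (1 - w))\<^sup>2"
    unfolding Re_divide cmod_power2 by (simp add: power2_eq_square algebra_simps diff_divide_distrib add_divide_distrib)
  also have "\<dots> > 0" using w w1 by (simp add: abs_square_less_1)
  finally show ?thesis using eq assms(1) by simp
qed

text \<open>\<open>fderiv F x\<close> is \<open>g x\<close> times a rank-one perturbation of the
  identity, hence explicitly invertible once \<open>p x\<close> is nonzero. Along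
  \<open>x\<^sub>0\<close> the factor is even, so the second coefficient vanishes and the third is
  \<open>1 - \<alpha>\<close>.\<close>

proposition extremal_mapping:
  fixes T :: "'a::complex_banach \<Rightarrow>\<^sub>L complex"
  assumes \<alpha>: "0 \<le> \<alpha>" "\<alpha> < 1" and x\<^sub>0: "norm x\<^sub>0 = 1" and T: "T \<in> support_functionals x\<^sub>0"
  defines "g \<equiv> \<lambda>x. extremal_factor \<alpha> (T x)"
  defines "F \<equiv> \<lambda>x. g x *\<^sub>C x"
  shows "frechet_holomorphic_on g (ball 0 1)" "g 0 = 1" "F \<in> starlike_mappings \<alpha>"
    "cmod (hankel_2_1 F x\<^sub>0 T) = 1 - \<alpha>"
proof -
  have Tc: "bounded_clinear (blinfun_apply T)" and Tn: "norm T = 1" and Tx: "T x\<^sub>0 = 1"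
    using T x\<^sub>0 by (auto simp: support_functionals_def)
  have Tscale: "T (c *\<^sub>C x) = c * T x" for c x
    using bounded_clinearD(2)[OF Tc] by (simp add: scaleC_complex_def)
  have Tlt: "cmod (T x) < 1" if "x \<in> ball 0 1" for x
    using norm_blinfun[of T x] Tn that by simp
  define \<kappa> where "\<kappa> = (\<lambda>x. extremal_log_derivative \<alpha> (T x))"
  have dg: "(g has_derivative (\<lambda>h. g x * \<kappa> x * T h)) (at x)" if "x \<in> ball 0 1" for x
    unfolding g_def \<kappa>_def
    by (rule has_derivative_compose[OF bounded_linear_imp_has_derivative[OF blinfun.bounded_linear_right]
          extremal_factor_has_field_derivative[OF Tlt[OF that], unfolded has_field_derivative_def]])
  have "bounded_clinear (\<lambda>h. g x * \<kappa> x * T h)" for x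
    unfolding bounded_clinear_def by (auto intro!: bounded_linear_intros simp: Tscale scaleC_complex_def)
  then show g: "frechet_holomorphic_on g (ball 0 1)"
    using dg unfolding frechet_holomorphic_on_def by blast
  show g0: "g 0 = 1" by (simp add: g_def extremal_factor_def blinfun.zero_right)
  have gne: "g x \<noteq> 0" for x by (simp add: g_def extremal_factor_def)
  have fg: "fderiv g x h = g x * \<kappa> x * T h" if "x \<in> ball 0 1" for x h
    using has_derivative_unique[OF frechet_holomorphic_onD(1)[OF g that] dg[OF that]] by metis
  have F: "F x = g x *\<^sub>C x" for x by (simp add: F_def)
  define R where "R = (\<lambda>x::'a. Blinfun (\<lambda>h. T h *\<^sub>C x))"
  have R: "R x h = T h *\<^sub>C x" for x h
    unfolding R_def
    by (subst bounded_linear_Blinfun_apply)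
      (auto intro!: bounded_linear_compose[OF bounded_bilinear.bounded_linear_left[OF bounded_bilinear_scaleC]]
        blinfun.bounded_linear_right)
  define D where "D = (\<lambda>x. g x *\<^sub>C (id_blinfun + \<kappa> x *\<^sub>C R x))"
  have D: "D x h = g x *\<^sub>C (h + (\<kappa> x * T h) *\<^sub>C x)" for x h
    by (simp add: D_def R scaleC_blinfun.rep_eq blinfun.add_left scaleC_scaleC)
  have dF: "(F has_derivative blinfun_apply (D x)) (at x)" if "x \<in> ball 0 1" for x
  proof -
    have "blinfun_apply (D x) = (\<lambda>h. g x *\<^sub>C h + fderiv g x h *\<^sub>C x)"
      by (auto simp: D fg[OF that] scaleC_add_right scaleC_scaleC mult.assoc)
    then show ?thesis using has_derivative_scaleC_self[OF g F that] by simp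
  qed
  then have fF: "fderiv F x = D x" if "x \<in> ball 0 1" for x
    using that by (intro fderiv_eqI)
  have holF: "frechet_holomorphic_on F (ball 0 1)"
    unfolding frechet_holomorphic_on_def
  proof (intro conjI ballI)
    fix x :: 'a assume x: "x \<in> ball 0 1"
    have "bounded_clinear (blinfun_apply (D x))"
      unfolding bounded_clinear_def
      by (auto simp: blinfun.bounded_linear_right D Tscale scaleC_add_right scaleC_scaleC mult_ac)
    then show "\<exists>D. bounded_clinear D \<and> (F has_derivative D) (at x)" using dF[OF x] by blast
  qed simp
  define p where "p = (\<lambda>x. 1 + \<kappa> x * T x)"
  have p: "\<alpha> < Re (p x)" if "x \<in> ball 0 1" for x
    unfolding p_def \<kappa>_def by (rule extremal_log_derivative_Re[OF \<alpha>(2) Tlt[OF that]])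
  have p0: "p x \<noteq> 0" if "x \<in> ball 0 1" for x using p[OF that] \<alpha> by auto
  have lb: "locally_biholomorphic F"
    unfolding locally_biholomorphic_def
  proof (intro conjI ballI holF)
    fix x :: 'a assume x: "x \<in> ball 0 1"
    \<comment> \<open>Sherman-Morrison: \<open>c\<close> solves
      \<open>\<kappa> x = c * (1 + \<kappa> x * T x)\<close>, which makes the rank-one terms cancel
      in both products.\<close>
    define c where "c = \<kappa> x / p x"
    define G where "G = (1 / g x) *\<^sub>C (id_blinfun - c *\<^sub>C R x)"
    have G: "G h = (1 / g x) *\<^sub>C (h - (c * T h) *\<^sub>C x)" for h
      by (simp add: G_def R scaleC_blinfun.rep_eq blinfun.diff_left scaleC_scaleC)
    have c1: "\<kappa> x - c * (1 + \<kappa> x * T x) = 0"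
      using p0[OF x] by (simp add: c_def p_def)
    have "G (D x h) = h" for h
    proof -
      have "T (D x h) = g x * (T h * (1 + \<kappa> x * T x))"
        by (simp add: D Tscale blinfun.add_right algebra_simps)
      then have "G (D x h) = h + ((\<kappa> x * T h) *\<^sub>C x - (c * (T h * (1 + \<kappa> x * T x))) *\<^sub>C x)"
        using gne[of x] by (simp add: G D scaleC_scaleC scaleC_diff_right)
      also have "\<dots> = h + (T h * (\<kappa> x - c * (1 + \<kappa> x * T x))) *\<^sub>C x"
        unfolding scaleC_diff_left[symmetric] by (simp add: algebra_simps)
      finally show ?thesis unfolding c1 by simp
    qed
    moreover have "D x (G h) = h" for h
    proof -
      have TG: "T (G h) = (1 / g x) * (T h - c * T h * T x)"
        unfolding G Tscale blinfun.diff_right ..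
      have "D x (G h) = h + ((\<kappa> x * (T h - c * T h * T x)) *\<^sub>C x - (c * T h) *\<^sub>C x)"
        unfolding D TG unfolding G
        using gne[of x] by (simp add: scaleC_scaleC scaleC_add_right scaleC_diff_right)
      also have "\<dots> = h + (T h * (\<kappa> x - c * (1 + \<kappa> x * T x))) *\<^sub>C x"
        unfolding scaleC_diff_left[symmetric] by (simp add: algebra_simps)
      finally show ?thesis unfolding c1 by simp
    qed
    ultimately have "G o\<^sub>L fderiv F x = id_blinfun \<and> fderiv F x o\<^sub>L G = id_blinfun"
      by (auto intro!: blinfun_eqI simp: fF[OF x])
    then show "\<exists>G. G o\<^sub>L fderiv F x = id_blinfun \<and> fderiv F x o\<^sub>L G = id_blinfun" ..
  qed
  have "normalized F"
    unfolding normalized_def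
  proof
    show "F 0 = 0" by (simp add: F)
    show "fderiv F 0 = id_blinfun"
      by (rule blinfun_eqI) (simp add: fF D g0 \<kappa>_def extremal_log_derivative_def blinfun.zero_right)
  qed
  moreover have "\<alpha> * (cmod (g x / (g x + fderiv g x x)))\<^sup>2 < Re (g x / (g x + fderiv g x x))"
    if x: "x \<in> ball 0 1" for x
  proof -
    have "g x + fderiv g x x = g x * p x"
      by (simp add: fg[OF x] p_def algebra_simps)
    then have "g x / (g x + fderiv g x x) = 1 / p x"
      using gne[of x] by simp
    \<comment> \<open>Since \<open>Re (1 / p x) = Re (p x) / (cmod (p x))\<^sup>2\<close>, the
      condition is \<open>\<alpha> < Re (p x)\<close> divided by the squared modulus.\<close>
    moreover have "\<alpha> * (cmod (1 / p x))\<^sup>2 < Re (1 / p x)"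
    proof -
      have "0 < (cmod (p x))\<^sup>2" using p0[OF x] by simp
      then have "\<alpha> / (cmod (p x))\<^sup>2 < Re (p x) / (cmod (p x))\<^sup>2"
        using p[OF x] by (rule divide_strict_right_mono[rotated])
      then show ?thesis by (simp add: norm_divide power_divide Re_divide' cmod_power2)
    qed
    ultimately show ?thesis by simp
  qed
  ultimately show "F \<in> starlike_mappings \<alpha>"
    using lb starlike_mappings_scaleC_self_iff[OF \<alpha>(1) g F] by blast
  let ?\<phi> = "\<lambda>\<zeta>. g (\<zeta> *\<^sub>C x\<^sub>0)"
  have \<phi>: "?\<phi> = extremal_factor \<alpha>" by (simp add: g_def Tscale Tx)
  let ?e = "extremal_factor \<alpha>" and ?l = "extremal_log_derivative \<alpha>"
  have d1: "deriv ?e \<zeta> = ?e \<zeta> * ?l \<zeta>" if "cmod \<zeta> < 1" for \<zeta>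
    by (rule DERIV_imp_deriv[OF extremal_factor_has_field_derivative[OF that]])
  have dl: "(?l has_field_derivative 2 * complex_of_real (1 - \<alpha>)) (at 0)"
    unfolding extremal_log_derivative_def[abs_def] by (rule derivative_eq_intros refl | simp)+
  have l0: "?l 0 = 0" and e0: "?e 0 = 1" by (simp_all add: extremal_log_derivative_def extremal_factor_def)
  have "((\<lambda>\<zeta>. ?e \<zeta> * ?l \<zeta>) has_field_derivative 2 * complex_of_real (1 - \<alpha>)) (at 0)"
    using DERIV_mult[OF extremal_factor_has_field_derivative[of 0 \<alpha>] dl] by (simp add: l0 e0)
  then have "(deriv ?e has_field_derivative 2 * complex_of_real (1 - \<alpha>)) (at 0)"
    by (rule has_field_derivative_transform_within_open[of _ _ _ "ball 0 1"]) (simp_all add: d1)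
  then have d2: "deriv (deriv ?e) 0 = 2 * complex_of_real (1 - \<alpha>)" by (rule DERIV_imp_deriv)
  have "hankel_2_1 F x\<^sub>0 T = complex_of_real (1 - \<alpha>)"
    unfolding hankel_2_1_scaleC_self[OF holF g F x\<^sub>0 T] \<phi> d2 by (simp add: d1 l0)
  then show "cmod (hankel_2_1 F x\<^sub>0 T) = 1 - \<alpha>" using \<alpha> by (simp only: norm_of_real)
qed

section \<open>The bound and its sharpness\<close>

theorem theorem3p3:
  fixes \<alpha> :: real
  assumes "\<exists>x :: 'a::complex_banach. x \<noteq> 0"
    and "0 \<le> \<alpha>" and "\<alpha> < 1"
  shows
    "(\<forall>(g :: 'a \<Rightarrow> complex) (F :: 'a \<Rightarrow> 'a).
        frechet_holomorphic_on g (ball 0 1) \<and> g 0 = 1 \<and>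
        (\<forall>x\<in>ball 0 1. F x = g x *\<^sub>C x) \<and> F \<in> starlike_mappings \<alpha> \<longrightarrow>
        (\<forall>x\<^sub>0 T. norm x\<^sub>0 = 1 \<and> T \<in> support_functionals x\<^sub>0 \<longrightarrow>
           cmod (hankel_2_1 F x\<^sub>0 T) \<le> 1 - \<alpha>)) \<and>
     (\<exists>(g :: 'a \<Rightarrow> complex) (F :: 'a \<Rightarrow> 'a) x\<^sub>0 T.
        frechet_holomorphic_on g (ball 0 1) \<and> g 0 = 1 \<and>
        (\<forall>x\<in>ball 0 1. F x = g x *\<^sub>C x) \<and> F \<in> starlike_mappings \<alpha> \<and>
        norm x\<^sub>0 = 1 \<and> T \<in> support_functionals x\<^sub>0 \<and>
        cmod (hankel_2_1 F x\<^sub>0 T) = 1 - \<alpha>)"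
proof (rule conjI)
  show "\<forall>(g :: 'a \<Rightarrow> complex) (F :: 'a \<Rightarrow> 'a).
        frechet_holomorphic_on g (ball 0 1) \<and> g 0 = 1 \<and>
        (\<forall>x\<in>ball 0 1. F x = g x *\<^sub>C x) \<and> F \<in> starlike_mappings \<alpha> \<longrightarrow>
        (\<forall>x\<^sub>0 T. norm x\<^sub>0 = 1 \<and> T \<in> support_functionals x\<^sub>0 \<longrightarrow>
           cmod (hankel_2_1 F x\<^sub>0 T) \<le> 1 - \<alpha>)"
    using hankel_2_1_starlike_bound[OF assms(2,3)] by blast
  obtain x :: 'a where "x \<noteq> 0" using assms(1) by blast
  then have x\<^sub>0: "norm (sgn x) = 1" by (simp add: norm_sgn)
  then have "sgn x \<noteq> 0" by auto
  \<comment> \<open>The same functional \<open>T\<close> defines the extremal mapping and enters its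
    coefficients.\<close>
  then obtain T where T: "T \<in> support_functionals (sgn x)" using support_functional_exists by blast
  show "\<exists>(g :: 'a \<Rightarrow> complex) (F :: 'a \<Rightarrow> 'a) x\<^sub>0 T.
        frechet_holomorphic_on g (ball 0 1) \<and> g 0 = 1 \<and>
        (\<forall>x\<in>ball 0 1. F x = g x *\<^sub>C x) \<and> F \<in> starlike_mappings \<alpha> \<and>
        norm x\<^sub>0 = 1 \<and> T \<in> support_functionals x\<^sub>0 \<and>
        cmod (hankel_2_1 F x\<^sub>0 T) = 1 - \<alpha>"
    by (intro exI[of _ "\<lambda>x. extremal_factor \<alpha> (T x)"]
        exI[of _ "\<lambda>x. extremal_factor \<alpha> (T x) *\<^sub>C x"] exI[of _ "sgn x"] exI[of _ T]
        conjI ballI refl x\<^sub>0 T extremal_mapping[OF assms(2,3) x\<^sub>0 T])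
qed

end
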